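(* Let $T$ be an $(s,n)$-table with $s\ge 1$, with entries $d_j$ and $\alpha_{i,j}$, and let $K=K(T)\subseteq R=\Bbbk[x_1,\ldots,x_n]$ be the associated monomial ideal. Then $R/K$ has the SLP in the narrow sense, and its maximal socle degree is $d_1+\cdots+d_n-\alpha_{1,1}-n$, unless $K=R$.
   Context: $\Bbbk$ is a field of characteristic zero and $R=\Bbbk[x_1,\ldots,x_n]$ is the standard graded polynomial ring. For $0\le s<n$, an $(s,n)$-table is an $(s+1)\times n$ matrix of nonnegative integers whose first (top) row is $(d_1,\ldots,d_n)$ and whose remaining rows are $(\alpha_{i,1},\ldots,\alpha_{i,n})$ for $1\le i\le s$, such that: (1) $\alpha_{i,j}=0$ for all $i>j$; (2) $\sum_{i=1}^{s}\alpha_{i,j}\le d_j$ for all $j$; (3) $d_k=\sum_{i=1}^{k-1}\alpha_{i,k}+\sum_{j=k+1}^{n}\alpha_{k,j}+\alpha_{k+1,k+1}$ for $1\le k\le s$, where one sets $\alpha_{s+1,s+1}=0$. The monomial ideal associated to $T$ is $K(T)=K_0(T)+K_1(T)+\cdots+K_s(T)$, where $K_0(T)=(x_1^{d_1},\ldots,x_n^{d_n})$ and, for $1\le k\le s$, \[K_k(T)=\Big(\prod_{j=1}^{k}x_j^{\,d_j-\sum_{i=1}^{j}\alpha_{i,j}}\Big)\cdot\Big(x_j^{\,d_j-\sum_{i=1}^{k}\alpha_{i,j}} : k+1\le j\le n\Big).\] For an Artinian graded algebra $A=\bigoplus_iA_i$, the maximal socle degree is the largest $r$ with $A_r\ne0$;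 $A$ has a symmetric Hilbert series if $\dim_\Bbbk A_i=\dim_\Bbbk A_{r-i}$ for all $0\le i\le r$. $A$ has the strong Lefschetz property (SLP) if there is a linear form $\ell$ such that for all $j\ge1$ and all $i$ the map $\cdot\ell^j:A_i\to A_{i+j}$ has maximal rank (injective or surjective). $A$ has the SLP in the narrow sense if it has the SLP and its Hilbert series is symmetric. *)

theory Defs
  imports "HOL-Library.Poly_Mapping" "HOL-Algebra.QuotRing" "HOL-Algebra.Embedded_Algebras"
begin

section \<open>The polynomial ring in the variables \<open>x\<^sub>1, \<dots>, x\<^sub>n\<close>\<close>

type_synonym 'a mpoly = "(nat \<Rightarrow>\<^sub>0 nat) \<Rightarrow>\<^sub>0 'a"

definition mpoly_ring :: "nat \<Rightarrow> ('a :: comm_ring_1) mpoly ring" where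
  "mpoly_ring n =
     \<lparr>carrier = {p. \<forall>m \<in> Poly_Mapping.keys p. Poly_Mapping.keys m \<subseteq> {1..n}},
      mult = (*), one = 1, zero = 0, add = (+)\<rparr>"

definition const :: "'a \<Rightarrow> ('a :: comm_ring_1) mpoly" where
  "const c = Poly_Mapping.single 0 c"

definition var :: "nat \<Rightarrow> ('a :: comm_ring_1) mpoly" where
  "var j = Poly_Mapping.single (Poly_Mapping.single j 1) 1"

definition mon_degree :: "(nat \<Rightarrow>\<^sub>0 nat) \<Rightarrow> nat" where
  "mon_degree m = (\<Sum>j \<in> Poly_Mapping.keys m. Poly_Mapping.lookup m j)"

definition homogeneous :: "nat \<Rightarrow> ('a :: comm_ring_1) mpoly \<Rightarrow> bool" where
  "homogeneous i p \<longleftrightarrow> (\<forall>m \<in> Poly_Mapping.keys p. mon_degree m = i)"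


section \<open>Graded quotients of the polynomial ring\<close>

definition quot_component ::
    "nat \<Rightarrow> ('a :: comm_ring_1) mpoly set \<Rightarrow> nat \<Rightarrow> 'a mpoly set set" where
  "quot_component n I i =
     (\<lambda>p. I +>\<^bsub>mpoly_ring n\<^esub> p) ` {p \<in> carrier (mpoly_ring n). homogeneous i p}"

text \<open>The image of the ground field, over which dimensions in the quotient are taken.\<close>

definition quot_scalars :: "nat \<Rightarrow> ('a :: comm_ring_1) mpoly set \<Rightarrow> 'a mpoly set set" where
  "quot_scalars n I = range (\<lambda>c. I +>\<^bsub>mpoly_ring n\<^esub> const c)"


section \<open>Lefschetz properties of graded algebras\<close>

text \<open>
  In this section \<open>Q\<close> is a ring, \<open>F\<close> its subset of scalars and \<open>A i\<close> its homogeneous component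
  of degree \<open>i\<close>.
\<close>

definition artinian_graded ::
    "('b, 'm) ring_scheme \<Rightarrow> 'b set \<Rightarrow> (nat \<Rightarrow> 'b set) \<Rightarrow> bool" where
  "artinian_graded Q F A \<longleftrightarrow>
     (\<forall>i. ring.finite_dimension Q F (A i)) \<and> (\<exists>N. \<forall>i > N. A i = {\<zero>\<^bsub>Q\<^esub>})"

definition max_socle_degree ::
    "('b, 'm) ring_scheme \<Rightarrow> (nat \<Rightarrow> 'b set) \<Rightarrow> nat \<Rightarrow> bool" where
  "max_socle_degree Q A r \<longleftrightarrow> A r \<noteq> {\<zero>\<^bsub>Q\<^esub>} \<and> (\<forall>i > r. A i = {\<zero>\<^bsub>Q\<^esub>})"

text \<open>The zero algebra has no maximal socle degree and counts as symmetric.\<close>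

definition symmetric_hilbert_series ::
    "('b, 'm) ring_scheme \<Rightarrow> 'b set \<Rightarrow> (nat \<Rightarrow> 'b set) \<Rightarrow> bool" where
  "symmetric_hilbert_series Q F A \<longleftrightarrow>
     (\<forall>r. max_socle_degree Q A r \<longrightarrow>
        (\<forall>i \<le> r. ring.dim Q F (A i) = ring.dim Q F (A (r - i))))"

definition strong_lefschetz :: "('b, 'm) ring_scheme \<Rightarrow> (nat \<Rightarrow> 'b set) \<Rightarrow> bool" where
  "strong_lefschetz Q A \<longleftrightarrow>
     (\<exists>l \<in> A 1. \<forall>j \<ge> 1. \<forall>i.
        inj_on (\<lambda>a. (l [^]\<^bsub>Q\<^esub> j) \<otimes>\<^bsub>Q\<^esub> a) (A i) \<or>
        (\<lambda>a. (l [^]\<^bsub>Q\<^esub> j) \<otimes>\<^bsub>Q\<^esub> a) ` A i = A (i + j))"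

definition strong_lefschetz_narrow ::
    "('b, 'm) ring_scheme \<Rightarrow> 'b set \<Rightarrow> (nat \<Rightarrow> 'b set) \<Rightarrow> bool" where
  "strong_lefschetz_narrow Q F A \<longleftrightarrow>
     artinian_graded Q F A \<and> strong_lefschetz Q A \<and> symmetric_hilbert_series Q F A"


section \<open>Tables and their monomial ideals\<close>

text \<open>
  The top row is \<open>d 1, \<dots>, d n\<close>; the entry in row \<open>i\<close> and column \<open>j\<close> below it is \<open>\<alpha> i j\<close>.
  Values of \<open>d\<close> and \<open>\<alpha>\<close> outside these index ranges are irrelevant.
\<close>

definition is_table :: "nat \<Rightarrow> nat \<Rightarrow> (nat \<Rightarrow> nat) \<Rightarrow> (nat \<Rightarrow> nat \<Rightarrow> nat) \<Rightarrow> bool" where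
  "is_table s n d \<alpha> \<longleftrightarrow>
     s < n \<and>
     (\<forall>i \<in> {1..s}. \<forall>j \<in> {1..n}. i > j \<longrightarrow> \<alpha> i j = 0) \<and>
     (\<forall>j \<in> {1..n}. (\<Sum>i=1..s. \<alpha> i j) \<le> d j) \<and>
     (\<forall>k \<in> {1..s}.
        d k = (\<Sum>i=1..<k. \<alpha> i k) + (\<Sum>j=k+1..n. \<alpha> k j)
              + (if k = s then 0 else \<alpha> (k+1) (k+1)))"

text \<open>
  For \<open>k \<le> s\<close> the truncated subtractions below are exact, by the first two conditions on a table.
\<close>

definition table_summand ::
    "nat \<Rightarrow> (nat \<Rightarrow> nat) \<Rightarrow> (nat \<Rightarrow> nat \<Rightarrow> nat) \<Rightarrow> nat \<Rightarrow> ('a :: comm_ring_1) mpoly set" where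
  "table_summand n d \<alpha> k =
     (\<Prod>j=1..k. var j ^ (d j - (\<Sum>i=1..j. \<alpha> i j))) <#\<^bsub>mpoly_ring n\<^esub>
     (Idl\<^bsub>mpoly_ring n\<^esub> ((\<lambda>j. var j ^ (d j - (\<Sum>i=1..k. \<alpha> i j))) ` {k+1..n}))"

primrec table_ideal ::
    "nat \<Rightarrow> nat \<Rightarrow> (nat \<Rightarrow> nat) \<Rightarrow> (nat \<Rightarrow> nat \<Rightarrow> nat) \<Rightarrow> ('a :: comm_ring_1) mpoly set" where
  "table_ideal 0 n d \<alpha> = Idl\<^bsub>mpoly_ring n\<^esub> ((\<lambda>j. var j ^ d j) ` {1..n})"
| "table_ideal (Suc k) n d \<alpha> =
     table_ideal k n d \<alpha> <+>\<^bsub>mpoly_ring n\<^esub> table_summand n d \<alpha> (Suc k)"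


section \<open>The structures involved are rings, ideals and fields of scalars\<close>

lemma mpoly_ring_simps [simp]:
  "mult (mpoly_ring n) = (*)" "one (mpoly_ring n) = 1"
  "zero (mpoly_ring n) = 0" "add (mpoly_ring n) = (+)"
  by (simp_all add: mpoly_ring_def)

lemma mem_carrier_mpoly_ring:
  "p \<in> carrier (mpoly_ring n) \<longleftrightarrow> (\<forall>m \<in> Poly_Mapping.keys p. Poly_Mapping.keys m \<subseteq> {1..n})"
  by (simp add: mpoly_ring_def)

lemma mult_mem_carrier:
  assumes "p \<in> carrier (mpoly_ring n)" "q \<in> carrier (mpoly_ring n)"
  shows "p * q \<in> carrier (mpoly_ring n)"
proof -
  have "Poly_Mapping.keys (a + b) \<subseteq> {1..n}"
    if "a \<in> Poly_Mapping.keys p" "b \<in> Poly_Mapping.keys q" for a b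
    using that assms keys_add[of a b] unfolding mem_carrier_mpoly_ring by blast
  then show ?thesis
    using keys_mult[of p q] unfolding mem_carrier_mpoly_ring by blast
qed

lemma cring_mpoly_ring: "cring (mpoly_ring n :: ('a :: comm_ring_1) mpoly ring)"
proof (rule cringI)
  show "abelian_group (mpoly_ring n :: 'a mpoly ring)"
  proof (rule abelian_groupI)
    fix p assume "p \<in> carrier (mpoly_ring n :: 'a mpoly ring)"
    then have "- p \<in> carrier (mpoly_ring n)"
      by (simp add: mem_carrier_mpoly_ring)
    then show "\<exists>q \<in> carrier (mpoly_ring n). q \<oplus>\<^bsub>mpoly_ring n\<^esub> p = \<zero>\<^bsub>mpoly_ring n\<^esub>"
      by (intro bexI[of _ "- p"]) simp_all
  next
    fix p q :: "'a mpoly"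
    assume "p \<in> carrier (mpoly_ring n)" "q \<in> carrier (mpoly_ring n)"
    then show "p \<oplus>\<^bsub>mpoly_ring n\<^esub> q \<in> carrier (mpoly_ring n)"
      using keys_add[of p q] by (auto simp: mem_carrier_mpoly_ring)
  qed (auto simp: mem_carrier_mpoly_ring algebra_simps)
  show "Group.comm_monoid (mpoly_ring n :: 'a mpoly ring)"
    by (rule comm_monoidI)
      (auto simp: mult_mem_carrier mem_carrier_mpoly_ring[of 1] algebra_simps)
qed (simp add: algebra_simps)

lemma var_power_mem_carrier:
  "j \<in> {1..n} \<Longrightarrow> var j ^ e \<in> carrier (mpoly_ring n)"
proof (induction e)
  case 0
  then show ?case by (simp add: mem_carrier_mpoly_ring)
next
  case (Suc e)
  then show ?case
    by (simp add: mult_mem_carrier) (rule mult_mem_carrier, auto simp: mem_carrier_mpoly_ring var_def)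
qed

lemma var_prod_mem_carrier:
  assumes "k \<le> n"
  shows "(\<Prod>j=1..k. var j ^ e j) \<in> carrier (mpoly_ring n)"
  using assms
proof (induction k)
  case 0
  then show ?case by (simp add: mem_carrier_mpoly_ring)
next
  case (Suc k)
  then show ?case
    by (simp add: prod.atLeastAtMost_shift_0 mult_mem_carrier var_power_mem_carrier)
qed

lemma (in cring) ideal_l_coset:
  assumes "ideal I R" "a \<in> carrier R"
  shows "ideal (a <# I) R"
proof -
  interpret I: ideal I R by fact
  have sub: "x \<in> I \<Longrightarrow> x \<in> carrier R" for x by (rule I.a_Hcarr)
  show ?thesis
  proof (rule idealI[OF ring_axioms])
    show "subgroup (a <# I) (add_monoid R)"
    proof (rule add.subgroupI)
      show "a <# I \<subseteq> carrier R" using assms(2) sub by (auto simp: l_coset_def)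
      show "a <# I \<noteq> {}" using I.zero_closed unfolding l_coset_def by blast
    next
      fix x assume "x \<in> a <# I"
      then obtain y where "y \<in> I" "x = a \<otimes> y" by (auto simp: l_coset_def)
      then show "\<ominus> x \<in> a <# I"
        using assms(2) sub by (auto simp: l_coset_def r_minus intro!: bexI[of _ "\<ominus> y"])
    next
      fix x x' assume "x \<in> a <# I" "x' \<in> a <# I"
      then obtain y y' where "y \<in> I" "x = a \<otimes> y" "y' \<in> I" "x' = a \<otimes> y'"
        by (auto simp: l_coset_def)
      then show "x \<oplus> x' \<in> a <# I"
        using assms(2) sub by (auto simp: l_coset_def r_distr intro!: bexI[of _ "y \<oplus> y'"])
    qed
  next
    fix x z assume "x \<in> a <# I" and z: "z \<in> carrier R"
    then obtain y where y: "y \<in> I" "x = a \<otimes> y" by (auto simp: l_coset_def)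
    then show "z \<otimes> x \<in> a <# I"
      using assms(2) sub z
      by (auto simp: l_coset_def m_lcomm I.I_l_closed intro!: bexI[of _ "z \<otimes> y"])
    show "x \<otimes> z \<in> a <# I"
      using y assms(2) sub z
      by (auto simp: l_coset_def m_assoc I.I_r_closed intro!: bexI[of _ "y \<otimes> z"])
  qed
qed

lemma ideal_table_summand:
  assumes "k \<le> n"
  shows "ideal (table_summand n d \<alpha> k) (mpoly_ring n)"
proof -
  interpret cring "mpoly_ring n :: 'a mpoly ring" by (rule cring_mpoly_ring)
  show ?thesis
    unfolding table_summand_def
    by (intro ideal_l_coset genideal_ideal var_prod_mem_carrier assms)
      (auto intro: var_power_mem_carrier)
qed

lemma ideal_table_ideal:
  "s < n \<Longrightarrow> ideal (table_ideal s n d \<alpha> :: ('a :: comm_ring_1) mpoly set) (mpoly_ring n)"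
proof (induction s)
  interpret cring "mpoly_ring n :: 'a mpoly ring" by (rule cring_mpoly_ring)
  case 0
  show ?case
    by (auto intro!: genideal_ideal var_power_mem_carrier)
next
  interpret cring "mpoly_ring n :: 'a mpoly ring" by (rule cring_mpoly_ring)
  case (Suc s)
  then show ?case
    by (auto intro!: add_ideals ideal_table_summand)
qed

lemma subfield_const:
  "subfield (range const) (mpoly_ring n :: ('a :: field) mpoly ring)"
proof -
  interpret C: cring "mpoly_ring n :: 'a mpoly ring" by (rule cring_mpoly_ring)
  let ?F = "range const :: 'a mpoly set"
  have cm: "const a * const b = const (a * b)" for a b :: 'a
    by (simp add: const_def mult_single)
  have ca: "const a + const b = const (a + b)" for a b :: 'a
    by (simp add: const_def single_add)
  have c0: "const 0 = (0 :: 'a mpoly)" and c1: "const 1 = (1 :: 'a mpoly)"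
    by (simp_all add: const_def)
  have cc: "const a \<in> carrier (mpoly_ring n)" for a :: 'a
    by (simp add: mem_carrier_mpoly_ring const_def)
  have cu: "\<ominus>\<^bsub>mpoly_ring n\<^esub> const a = const (- a)" for a :: 'a
    by (rule C.minus_equality) (simp_all add: cc ca c0)
  show ?thesis
  proof (rule C.subfieldI)
    have "1 \<in> ?F" using c1 by (metis rangeI)
    then show "subcring ?F (mpoly_ring n)"
      by (intro C.subcringI' C.subringI) (auto simp: cc cm ca cu)
    have "const a \<noteq> 0" if "const a * const b = 1" for a b :: 'a
      using that by auto
    moreover have "const a * const (inverse a) = 1" if "const a \<noteq> 0" for a :: 'a
      using that c0 c1 by (cases "a = 0") (auto simp: cm)
    ultimately show "Units (mpoly_ring n \<lparr>carrier := ?F\<rparr>) = ?F - {\<zero>\<^bsub>mpoly_ring n\<^esub>}"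
      by (fastforce simp: Units_def mult.commute)
  qed
qed

lemma subfield_quot_scalars:
  fixes I :: "('a :: field) mpoly set"
  assumes "ideal I (mpoly_ring n)" "I \<noteq> carrier (mpoly_ring n)"
  shows "subfield (quot_scalars n I) (mpoly_ring n Quot I)"
proof -
  interpret I: ideal I "mpoly_ring n" by fact
  interpret h: ring_hom_ring "mpoly_ring n" "mpoly_ring n Quot I" "(+>\<^bsub>mpoly_ring n\<^esub>) I"
    by (rule I.rcos_ring_hom_ring)
  have "\<one>\<^bsub>mpoly_ring n Quot I\<^esub> \<noteq> \<zero>\<^bsub>mpoly_ring n Quot I\<^esub>"
    using assms(2) I.one_imp_carrier I.a_rcos_self[OF I.one_closed]
    by (auto simp: FactRing_def)
  from h.img_is_subfield(2)[OF subfield_const this] show ?thesis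
    by (simp add: quot_scalars_def image_image)
qed

end

(*
Extend alpha by zero below row s and let e k j = d j - (alpha 1 j + ... + alpha k j).  Sort
the monomials outside K by the first k with the exponent of x_(k+1) below e (k+1) (k+1):
they fall into s + 1 boxes, the k-th of which is the difference of two consecutive members
of a decreasing chain of monomial ideals ending in K.  So R/K is filtered by shifted monomial
complete intersections, and condition (3) on a table makes all these boxes concentric.

On a box, multiplication by the sum of the variables is the raising operator of an
sl_2-representation, so its powers are injective up to the reflected degree; injectivity
passes through the filtration.  Reflecting each box in its centre makes the Hilbert series
symmetric, and surjectivity then follows by comparing dimensions.
*)

theory Submission
  imports Defs
begin

section \<open>Injectivity from an \<open>sl\<^sub>2\<close>-type commutation relation\<close>

text \<open>The quotient \<open>R/K\<close> has no evident sl_2-action of its own, since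
  multiplication by a variable can lead out of a box. It then leads only into a later box or into
  \<open>K\<close>, because box \<open>k\<close> is what remains of the ideal
  \<open>K + (x_1^(e 1 1) ... x_k^(e k k))\<close> after removing its successor. So a representation
  is needed on each subquotient only, and injectivity on all of them is enough provided that the
  degree bound is the same for every box; being concentric supplies exactly this.

  The constant comes from the box \<open>k = 0\<close>, with sides
  \<open>[0, d 1 - \<alpha> 1 1)\<close> and \<open>[0, d j)\<close> for \<open>j >= 2\<close>: if
  it is nonempty, its extreme degrees are \<open>0\<close> and
  \<open>r = d 1 + ... + d n - \<alpha> 1 1 - n\<close>. Boxes can be empty, and \<open>r\<close>
  can be negative when \<open>K = R\<close>; hence \<open>r\<close> is an integer and a box is
  measured by the formal sum of all \<open>u j + v j - 1\<close>, which makes sense in every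
  case.\<close>

lemma lowering_raising_power:
  fixes E F :: "('m \<Rightarrow> 'k :: comm_ring_1) \<Rightarrow> 'm \<Rightarrow> 'k" and V :: "nat \<Rightarrow> ('m \<Rightarrow> 'k) set" and r :: int
  assumes lin: "\<And>f g c. E (\<lambda>m. f m + c * g m) = (\<lambda>m. E f m + c * E g m)"
    and EV: "\<And>i f. f \<in> V i \<Longrightarrow> E f \<in> V (Suc i)"
    and comm: "\<And>i f. f \<in> V i \<Longrightarrow> F (E f) = (\<lambda>m. E (F f) m + of_int (r - 2 * int i) * f m)"
    and f: "f \<in> V i"
  shows "F ((E ^^ Suc k) f) =
    (\<lambda>m. (E ^^ Suc k) (F f) m + of_int (int (Suc k) * (r - 2 * int i - int k)) * (E ^^ k) f m)"
proof (induction k)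
  case 0
  then show ?case using comm[OF f] by simp
next
  case (Suc k)
  have V: "(E ^^ k) f \<in> V (i + k)" for k
    by (induction k) (use f EV in auto)
  have "F ((E ^^ Suc (Suc k)) f) = F (E ((E ^^ Suc k) f))" by simp
  also have "\<dots> = (\<lambda>m. E (F ((E ^^ Suc k) f)) m + of_int (r - 2 * int (i + Suc k)) * (E ^^ Suc k) f m)"
    by (rule comm[OF V])
  also have "E (F ((E ^^ Suc k) f)) = (\<lambda>m. (E ^^ Suc (Suc k)) (F f) m
      + of_int (int (Suc k) * (r - 2 * int i - int k)) * (E ^^ Suc k) f m)"
    unfolding Suc.IH lin by simp
  \<comment> \<open>The scalar is the sum of the values \<open>r - 2(i + j)\<close> attached to
    \<open>E^j f\<close> for \<open>j = 0, ..., k\<close>. One more summand turns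
    \<open>(k+1)(r-2i-k)\<close> into \<open>(k+2)(r-2i-k-1)\<close>.\<close>
  finally show ?case
    by (simp add: algebra_simps)
qed

text \<open>Induction on \<open>i\<close>, for all \<open>k\<close> at once. If \<open>E^k\<close>
  kills \<open>f\<close>, the commutation formula shows that \<open>E^(k+1)\<close> kills
  \<open>F f\<close>; the degree drops by one while the exponent grows by one, so the bound survives
  and \<open>F f = 0\<close>. For such a primitive \<open>f\<close> the formula makes
  \<open>F (E^(k+1) f)\<close> a nonzero multiple of \<open>E^k f\<close>, so the exponent can be
  lowered until \<open>f\<close> itself is zero.\<close>

lemma raising_power_injective:
  fixes E F :: "('m \<Rightarrow> 'k :: field_char_0) \<Rightarrow> 'm \<Rightarrow> 'k" and V :: "nat \<Rightarrow> ('m \<Rightarrow> 'k) set" and r :: int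
  assumes lin: "\<And>f g c. E (\<lambda>m. f m + c * g m) = (\<lambda>m. E f m + c * E g m)"
    and EV: "\<And>i f. f \<in> V i \<Longrightarrow> E f \<in> V (Suc i)"
    and FV: "\<And>i f. f \<in> V (Suc i) \<Longrightarrow> F f \<in> V i"
    and FV0: "\<And>f. f \<in> V 0 \<Longrightarrow> F f = (\<lambda>_. 0)"
    and F0: "F (\<lambda>_. 0) = (\<lambda>_. 0)"
    and comm: "\<And>i f. f \<in> V i \<Longrightarrow> F (E f) = (\<lambda>m. E (F f) m + of_int (r - 2 * int i) * f m)"
    and "f \<in> V i" "2 * int i + int k \<le> r" "(E ^^ k) f = (\<lambda>_. 0)"
  shows "f = (\<lambda>_. 0)"
  using assms(7-)
proof (induction i arbitrary: f k)
  have E0: "E (\<lambda>_. 0) = (\<lambda>_. 0)" using lin[of "\<lambda>_. 0" "-1" "\<lambda>_. 0"] by simp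
  have step: "(E ^^ k) f = (\<lambda>_. 0)"
    if f: "f \<in> V i" "F f = (\<lambda>_. 0)" and k: "(E ^^ Suc k) f = (\<lambda>_. 0)" "2 * int i + int (Suc k) \<le> r" for f i k
  proof -
    have "(E ^^ j) (\<lambda>_. 0) = (\<lambda>_. 0)" for j
      by (induction j) (auto simp: E0)
    from lowering_raising_power[of E V F, OF lin EV comm f(1), of k, unfolded f(2) this k(1) F0]
    have "of_int (int (Suc k) * (r - 2 * int i - int k)) * (E ^^ k) f m = 0" for m
      by (metis add_0)
    \<comment> \<open>The bound gives \<open>r - 2i - k >= 1\<close>; characteristic zero keeps this
      nonzero in the field.\<close>
    moreover have "int (Suc k) * (r - 2 * int i - int k) \<noteq> 0" using k(2) by simp
    ultimately show ?thesis by (metis mult_eq_0_iff of_int_eq_0_iff)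
  qed
  {
    case 0
    have "F f = (\<lambda>_. 0)" using FV0 0(1) .
    with 0 show ?case
      by (induction k) (use step[of f 0] in fastforce)+
  next
    case (Suc i)
    have "F f = (\<lambda>_. 0)" if "2 * int (Suc i) + int k \<le> r" "(E ^^ k) f = (\<lambda>_. 0)" for k
    proof (rule Suc.IH[of "F f" "Suc k"])
      show "F f \<in> V i" using FV Suc.prems(1) by simp
      show "2 * int i + int (Suc k) \<le> r" using that by simp
      have 0: "(E ^^ Suc k) f = (\<lambda>_. 0)" using that E0 by simp
      from lowering_raising_power[of E V F, OF lin EV comm Suc.prems(1), of k, unfolded 0 that F0]
      show "(E ^^ Suc k) (F f) = (\<lambda>_. 0)" by simp
    qed
    with Suc.prems show ?case
      by (induction k) (use step[of f "Suc i"] in fastforce)+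
  }
qed

section \<open>Degrees of monomials\<close>

lemma mon_degree_superset:
  assumes "Poly_Mapping.keys m \<subseteq> J" "finite J"
  shows "mon_degree m = (\<Sum>j\<in>J. Poly_Mapping.lookup m j)"
  unfolding mon_degree_def
  by (rule sum.mono_neutral_left) (use assms in \<open>auto simp: in_keys_iff\<close>)

lemma mon_degree_add: "mon_degree (a + b) = mon_degree a + mon_degree b"
proof -
  let ?J = "Poly_Mapping.keys a \<union> Poly_Mapping.keys b"
  have "Poly_Mapping.keys (a + b) \<subseteq> ?J" by (rule keys_add)
  then show ?thesis
    by (simp add: mon_degree_superset[of _ ?J] lookup_add sum.distrib)
qed

lemma mon_degree_single [simp]: "mon_degree (Poly_Mapping.single j e) = e"
  by (simp add: mon_degree_def)

lemma minus_single_add_single: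
  "0 < Poly_Mapping.lookup m j \<Longrightarrow> m - Poly_Mapping.single j (1::nat) + Poly_Mapping.single j 1 = m"
  by (rule poly_mapping_eqI) (auto simp: lookup_add lookup_minus lookup_single when_def)

lemma mon_degree_minus_single:
  assumes "0 < Poly_Mapping.lookup m j"
  shows "mon_degree m = Suc (mon_degree (m - Poly_Mapping.single j 1))"
  using mon_degree_add[of "m - Poly_Mapping.single j 1" "Poly_Mapping.single j 1"]
  by (simp only: minus_single_add_single[OF assms] mon_degree_single Suc_eq_plus1)

section \<open>Boxes of monomials\<close>

text \<open>Sides are half-open, so a direction with \<open>v j <= u j\<close> makes the box empty.
  Tables with a zero diagonal entry produce such boxes.\<close>

definition box :: "nat set \<Rightarrow> (nat \<Rightarrow> nat) \<Rightarrow> (nat \<Rightarrow> nat) \<Rightarrow> (nat \<Rightarrow>\<^sub>0 nat) set" where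
  "box J u v = {m. Poly_Mapping.keys m \<subseteq> J \<and>
     (\<forall>j\<in>J. u j \<le> Poly_Mapping.lookup m j \<and> Poly_Mapping.lookup m j < v j)}"

definition box_graded :: "(nat \<Rightarrow>\<^sub>0 nat) set \<Rightarrow> nat \<Rightarrow> ((nat \<Rightarrow>\<^sub>0 nat) \<Rightarrow> 'k :: zero) set" where
  "box_graded B i = {f. \<forall>m. f m \<noteq> 0 \<longrightarrow> m \<in> B \<and> mon_degree m = i}"

text \<open>In terms of coefficient functions this is multiplication by the sum of the variables,
  followed by discarding what leaves the box: the coefficient at \<open>m\<close> collects those at
  the monomials \<open>m / x_j\<close> inside the box.\<close>

definition box_raise ::
    "nat set \<Rightarrow> (nat \<Rightarrow> nat) \<Rightarrow> (nat \<Rightarrow> nat) \<Rightarrow> ((nat \<Rightarrow>\<^sub>0 nat) \<Rightarrow> 'k) \<Rightarrow> (nat \<Rightarrow>\<^sub>0 nat) \<Rightarrow> 'k :: comm_ring_1"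
  where "box_raise J u v f m = (if m \<in> box J u v
     then \<Sum>j\<in>J. if u j < Poly_Mapping.lookup m j then f (m - Poly_Mapping.single j 1) else 0 else 0)"

text \<open>On a factor spanned by \<open>x^u, \<dots>, x^(v-1)\<close> the lowering operator is
  \<open>x^t \<mapsto> (t - u) (v - t) x^(t-1)\<close>, as in the irreducible \<open>sl\<^sub>2\<close>-representation of dimension \<open>v - u\<close>.\<close>

definition box_lower ::
    "nat set \<Rightarrow> (nat \<Rightarrow> nat) \<Rightarrow> (nat \<Rightarrow> nat) \<Rightarrow> ((nat \<Rightarrow>\<^sub>0 nat) \<Rightarrow> 'k) \<Rightarrow> (nat \<Rightarrow>\<^sub>0 nat) \<Rightarrow> 'k :: comm_ring_1"
  where "box_lower J u v f m = (if m \<in> box J u v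
     then \<Sum>j\<in>J. if Suc (Poly_Mapping.lookup m j) < v j
       then of_int ((int (Poly_Mapping.lookup m j) + 1 - int (u j)) * (int (v j) - (int (Poly_Mapping.lookup m j) + 1)))
         * f (m + Poly_Mapping.single j 1) else 0
     else 0)"

lemma plus_single_mem_box:
  assumes "m \<in> box J u v" "j \<in> J"
  shows "m + Poly_Mapping.single j 1 \<in> box J u v \<longleftrightarrow> Suc (Poly_Mapping.lookup m j) < v j"
proof -
  have "Poly_Mapping.keys (m + Poly_Mapping.single j (1::nat)) \<subseteq> J"
    using keys_add[of m "Poly_Mapping.single j 1"] assms by (auto simp: box_def)
  then show ?thesis
    using assms by (auto simp: box_def lookup_add lookup_single when_def)
qed

lemma minus_single_mem_box:
  assumes "m \<in> box J u v" "j \<in> J" "0 < Poly_Mapping.lookup m j"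
  shows "m - Poly_Mapping.single j 1 \<in> box J u v \<longleftrightarrow> u j < Poly_Mapping.lookup m j"
proof -
  have "Poly_Mapping.keys (m - Poly_Mapping.single j (1::nat)) \<subseteq> J"
    using assms by (auto simp: box_def in_keys_iff lookup_minus)
  then show ?thesis
    using assms by (auto simp: box_def lookup_minus lookup_single when_def)
qed

text \<open>Raising in one variable commutes with lowering in another, so only the diagonal terms
  survive. With \<open>c(t) = (t - u)(v - t)\<close> these give
  \<open>c(t+1) - c(t) = u + v - 1 - 2t\<close>, and summing over the variables yields
  \<open>r - 2 deg m\<close>.\<close>

lemma box_commutation:
  fixes f :: "(nat \<Rightarrow>\<^sub>0 nat) \<Rightarrow> 'k :: comm_ring_1"
  assumes J: "finite J" and r: "r = (\<Sum>j\<in>J. int (u j) + int (v j) - 1)"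
    and f: "f \<in> box_graded (box J u v) i"
  shows "box_lower J u v (box_raise J u v f) =
    (\<lambda>m. box_raise J u v (box_lower J u v f) m + of_int (r - 2 * int i) * f m)"
proof
  fix m
  let ?B = "box J u v" and ?x = "\<lambda>j. Poly_Mapping.single j (1::nat)" and ?l = "Poly_Mapping.lookup"
  let ?c = "\<lambda>j t. (t - int (u j)) * (int (v j) - t)"
  show "box_lower J u v (box_raise J u v f) m =
    box_raise J u v (box_lower J u v f) m + of_int (r - 2 * int i) * f m"
  proof (cases "m \<in> ?B")
    case False
    then have "f m = 0" using f by (auto simp: box_graded_def)
    with False show ?thesis by (simp add: box_lower_def box_raise_def)
  next
    case True
    define a where "a j l = (if Suc (?l m j) < v j \<and> u l < ?l (m + ?x j) l
      then of_int (?c j (int (?l m j) + 1)) * f (m + ?x j - ?x l) else 0)" for j l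
    define b where "b j l = (if u l < ?l m l \<and> Suc (?l (m - ?x l) j) < v j
      then of_int (?c j (int (?l (m - ?x l) j) + 1)) * f (m - ?x l + ?x j) else 0)" for j l
    have L: "box_lower J u v (box_raise J u v f) m = (\<Sum>j\<in>J. \<Sum>l\<in>J. a j l)"
    proof -
      have "box_raise J u v f (m + ?x j) =
          (\<Sum>l\<in>J. if u l < ?l (m + ?x j) l then f (m + ?x j - ?x l) else 0)"
        if "j \<in> J" "Suc (?l m j) < v j" for j
        using plus_single_mem_box[OF True that(1)] that(2) by (simp add: box_raise_def del: One_nat_def)
      then have "(if Suc (?l m j) < v j then of_int (?c j (int (?l m j) + 1)) * box_raise J u v f (m + ?x j) else 0)
          = (\<Sum>l\<in>J. a j l)" if "j \<in> J" for j
        using that unfolding a_def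
        by (cases "Suc (?l m j) < v j")
          (auto simp: sum_distrib_left simp del: One_nat_def of_int_mult intro!: sum.cong)
      with True show ?thesis
        unfolding box_lower_def[of _ _ _ _ m] by (auto intro!: sum.cong)
    qed
    have R: "box_raise J u v (box_lower J u v f) m = (\<Sum>j\<in>J. \<Sum>l\<in>J. b j l)"
    proof -
      have "box_lower J u v f (m - ?x l) = (\<Sum>j\<in>J. if Suc (?l (m - ?x l) j) < v j
          then of_int (?c j (int (?l (m - ?x l) j) + 1)) * f (m - ?x l + ?x j) else 0)"
        if "l \<in> J" "u l < ?l m l" for l
        using minus_single_mem_box[OF True that(1)] that(2)
        by (simp add: box_lower_def del: One_nat_def of_int_mult)
      then have "(if u l < ?l m l then box_lower J u v f (m - ?x l) else 0) = (\<Sum>j\<in>J. b j l)"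
        if "l \<in> J" for l
        using that unfolding b_def
        by (cases "u l < ?l m l") (auto simp del: One_nat_def of_int_mult intro!: sum.cong)
      with True have "box_raise J u v (box_lower J u v f) m = (\<Sum>l\<in>J. \<Sum>j\<in>J. b j l)"
        unfolding box_raise_def[of _ _ _ _ m] by (auto intro!: sum.cong)
      then show ?thesis by (subst sum.swap)
    qed
    have off: "a j l = b j l" if "j \<noteq> l" for j l
    proof -
      have "m + ?x j - ?x l = m - ?x l + ?x j"
        using that by (intro poly_mapping_eqI) (auto simp: lookup_add lookup_minus lookup_single when_def)
      then show ?thesis
        using that by (auto simp: a_def b_def lookup_add lookup_minus lookup_single when_def)
    qed
    have diag: "a j j - b j j = of_int (int (u j) + int (v j) - 1 - 2 * int (?l m j)) * f m"
      if j: "j \<in> J" for j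
    proof -
      have uv: "u j \<le> ?l m j" "?l m j < v j" using True j by (auto simp: box_def)
      \<comment> \<open>\<open>?c\<close> vanishes at \<open>v j\<close>, and likewise at
        \<open>u j\<close> in \<open>B\<close>, so the formula also holds at the ends of a side,
        where the term is absent.\<close>
      have A: "a j j = of_int (?c j (int (?l m j) + 1)) * f m"
      proof (cases "Suc (?l m j) < v j")
        case False
        then have "int (v j) - (int (?l m j) + 1) = 0" using uv by simp
        then show ?thesis using False by (simp add: a_def)
      qed (use uv in \<open>simp add: a_def lookup_add\<close>)
      have B: "b j j = of_int (?c j (int (?l m j))) * f m"
      proof (cases "u j < ?l m j")
        case True
        then have "Suc (?l (m - ?x j) j) = ?l m j" by (simp add: lookup_minus)
        then have "int (?l (m - ?x j) j) + 1 = int (?l m j)" by linarith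
        with True uv show ?thesis
          by (simp add: b_def minus_single_add_single[unfolded One_nat_def] lookup_minus)
      qed (use uv in \<open>simp add: b_def\<close>)
      show ?thesis unfolding A B by (simp add: algebra_simps)
    qed
    have "(\<Sum>l\<in>J. a j l - b j l) = of_int (int (u j) + int (v j) - 1 - 2 * int (?l m j)) * f m"
      if "j \<in> J" for j
    proof -
      have "(\<Sum>l\<in>J. a j l - b j l) = (\<Sum>l\<in>J. if l = j then a j j - b j j else 0)"
        by (rule sum.cong) (auto simp: off)
      then show ?thesis using J that by (simp add: diag)
    qed
    then have "(\<Sum>j\<in>J. \<Sum>l\<in>J. a j l) - (\<Sum>j\<in>J. \<Sum>l\<in>J. b j l) =
        of_int (\<Sum>j\<in>J. int (u j) + int (v j) - 1 - 2 * int (?l m j)) * f m"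
      by (simp add: sum_subtractf[symmetric] sum_distrib_right[symmetric])
    also have "\<dots> = of_int (r - 2 * int i) * f m"
    proof (cases "f m = 0")
      case False
      then have "mon_degree m = i" using f by (auto simp: box_graded_def)
      moreover have "mon_degree m = (\<Sum>j\<in>J. ?l m j)"
        using True J by (intro mon_degree_superset) (auto simp: box_def)
      ultimately have "int i = (\<Sum>j\<in>J. int (?l m j))" by (metis of_nat_sum)
      then have "(\<Sum>j\<in>J. int (u j) + int (v j) - 1 - 2 * int (?l m j)) = r - 2 * int i"
        unfolding r by (simp add: sum_subtractf sum_distrib_left)
      then show ?thesis by simp
    qed simp
    finally show ?thesis unfolding L R by (simp add: algebra_simps)
  qed
qed

text \<open>For a nonempty box \<open>r\<close> is its least plus its greatest degree, so the bound
  says \<open>i + k <= r - i\<close>: the target degree does not exceed the mirror image of the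
  source degree.\<close>

lemma box_raise_injective:
  fixes f :: "(nat \<Rightarrow>\<^sub>0 nat) \<Rightarrow> 'k :: field_char_0"
  assumes J: "finite J" and r: "r = (\<Sum>j\<in>J. int (u j) + int (v j) - 1)"
    and f: "f \<in> box_graded (box J u v) i" and k: "2 * int i + int k \<le> r"
    and 0: "(box_raise J u v ^^ k) f = (\<lambda>_. 0)"
  shows "f = (\<lambda>_. 0)"
proof (rule raising_power_injective[where E = "box_raise J u v" and F = "box_lower J u v"
      and V = "box_graded (box J u v)" and r = r, OF _ _ _ _ _ box_commutation[OF J r] f k 0])
  let ?B = "box J u v"
  show "box_raise J u v (\<lambda>m. f m + c * g m) = (\<lambda>m. box_raise J u v f m + c * box_raise J u v g m)"
    for f g :: "(nat \<Rightarrow>\<^sub>0 nat) \<Rightarrow> 'k" and c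
    by (auto simp: box_raise_def fun_eq_iff sum_distrib_left sum.distrib[symmetric] intro!: sum.cong)
  show "box_lower J u v (\<lambda>_. 0) = (\<lambda>_. 0 :: 'k)"
    by (auto simp: box_lower_def fun_eq_iff intro!: sum.neutral)
  show "box_raise J u v f \<in> box_graded ?B (Suc i)" if "f \<in> box_graded ?B i" for i and f :: "_ \<Rightarrow> 'k"
  proof -
    have "m \<in> ?B \<and> mon_degree m = Suc i" if "box_raise J u v f m \<noteq> 0" for m
    proof -
      from that have m: "m \<in> ?B" and s: "(\<Sum>j\<in>J. if u j < Poly_Mapping.lookup m j
          then f (m - Poly_Mapping.single j 1) else 0) \<noteq> 0"
        by (auto simp: box_raise_def split: if_splits)
      from sum.not_neutral_contains_not_neutral[OF s]
      obtain j where "u j < Poly_Mapping.lookup m j" "f (m - Poly_Mapping.single j 1) \<noteq> 0"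
        by (metis (full_types))
      with m have "m \<in> ?B" "u j < Poly_Mapping.lookup m j" "f (m - Poly_Mapping.single j 1) \<noteq> 0" by simp_all
      then show ?thesis
        using \<open>f \<in> _\<close> mon_degree_minus_single[of m j] by (auto simp: box_graded_def)
    qed
    then show ?thesis by (simp add: box_graded_def)
  qed
  have low: "\<exists>j. m \<in> ?B \<and> f (m + Poly_Mapping.single j 1) \<noteq> 0" if "box_lower J u v f m \<noteq> 0"
    for m and f :: "_ \<Rightarrow> 'k"
    using that unfolding box_lower_def
    by (auto split: if_splits elim!: sum.not_neutral_contains_not_neutral)
  show "box_lower J u v f \<in> box_graded ?B i" if "f \<in> box_graded ?B (Suc i)" for i and f :: "_ \<Rightarrow> 'k"
    using low[of f] that by (fastforce simp: box_graded_def mon_degree_add)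
  show "box_lower J u v f = (\<lambda>_. 0)" if "f \<in> box_graded ?B 0" for f :: "_ \<Rightarrow> 'k"
    using low[of f] that by (fastforce simp: box_graded_def mon_degree_add)
qed

section \<open>Monomial ideals\<close>

definition monomials :: "nat \<Rightarrow> (nat \<Rightarrow>\<^sub>0 nat) set" where
  "monomials n = {m. Poly_Mapping.keys m \<subseteq> {1..n}}"

text \<open>For upward closed \<open>S\<close> this is a monomial ideal. For other \<open>S\<close>
  it is merely a span of monomials, and serves to describe the components of a quotient.\<close>

definition supported :: "(nat \<Rightarrow>\<^sub>0 nat) set \<Rightarrow> ('a :: zero) mpoly set" where
  "supported S = {p. Poly_Mapping.keys p \<subseteq> S}"

definition up_closed :: "nat \<Rightarrow> (nat \<Rightarrow>\<^sub>0 nat) set \<Rightarrow> bool" where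
  "up_closed n S \<longleftrightarrow> S \<subseteq> monomials n \<and> (\<forall>a\<in>monomials n. \<forall>m\<in>S. a + m \<in> S)"

lemma carrier_eq_supported: "carrier (mpoly_ring n) = supported (monomials n)"
  unfolding set_eq_iff mem_carrier_mpoly_ring supported_def monomials_def by blast

lemma mem_monomials_lookup: "m \<in> monomials n \<longleftrightarrow> (\<forall>j. j \<notin> {1..n} \<longrightarrow> Poly_Mapping.lookup m j = 0)"
  unfolding monomials_def by (auto simp: in_keys_iff)

lemma add_mem_monomials [simp]: "a + b \<in> monomials n \<longleftrightarrow> a \<in> monomials n \<and> b \<in> monomials n"
  by (auto simp: mem_monomials_lookup lookup_add)

lemma minus_mem_monomials: "a \<in> monomials n \<Longrightarrow> a - b \<in> monomials n"
  by (auto simp: mem_monomials_lookup lookup_minus)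

lemma single_mem_monomials: "j \<in> {1..n} \<Longrightarrow> Poly_Mapping.single j e \<in> monomials n"
  by (auto simp: mem_monomials_lookup lookup_single when_def)

lemma up_closed_monomials: "up_closed n (monomials n)"
  by (simp add: up_closed_def)

lemma up_closed_Un: "up_closed n S \<Longrightarrow> up_closed n T \<Longrightarrow> up_closed n (S \<union> T)"
  by (auto simp: up_closed_def)

lemma supported_add: "p \<in> supported S \<Longrightarrow> q \<in> supported S \<Longrightarrow> p + q \<in> supported S"
  for p q :: "('a :: monoid_add) mpoly"
  using keys_add[of p q] by (auto simp: supported_def)

lemma supported_sum:
  "(\<And>x. x \<in> A \<Longrightarrow> f x \<in> supported S) \<Longrightarrow> sum f A \<in> supported S"
  for f :: "_ \<Rightarrow> ('a :: comm_monoid_add) mpoly"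
proof (induction A rule: infinite_finite_induct)
  case (insert x A)
  then show ?case by (simp add: supported_add)
qed (simp_all add: supported_def)

lemma supported_uminus: "p \<in> supported S \<Longrightarrow> - p \<in> supported S"
  for p :: "('a :: ab_group_add) mpoly"
  by (auto simp: supported_def in_keys_iff)

lemma supported_diff: "p \<in> supported S \<Longrightarrow> q \<in> supported S \<Longrightarrow> p - q \<in> supported S"
  for p q :: "('a :: ab_group_add) mpoly"
  by (auto simp: supported_def in_keys_iff lookup_minus subset_iff) (metis diff_0_right)

lemma supported_mult:
  assumes "up_closed n S" "p \<in> supported (monomials n)" "q \<in> supported S"
  shows "p * q \<in> supported S"
  using keys_mult[of p q] assms unfolding supported_def up_closed_def by blast

lemma supported_power_mult:
  assumes "up_closed n S" "p \<in> supported (monomials n)" "q \<in> supported S"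
  shows "p ^ k * q \<in> supported (S :: (nat \<Rightarrow>\<^sub>0 nat) set)"
  by (induction k) (use assms in \<open>auto simp: mult.assoc intro: supported_mult\<close>)

lemma ideal_supported:
  assumes "up_closed n S"
  shows "ideal (supported S :: ('a :: comm_ring_1) mpoly set) (mpoly_ring n)"
proof -
  interpret cring "mpoly_ring n :: 'a mpoly ring" by (rule cring_mpoly_ring)
  have sub: "supported S \<subseteq> (supported (monomials n) :: 'a mpoly set)"
    using assms by (auto simp: supported_def up_closed_def)
  show ?thesis
  proof (rule idealI[OF ring_axioms])
    show "subgroup (supported S :: 'a mpoly set) (add_monoid (mpoly_ring n))"
    proof (rule add.subgroupI)
      show "supported S \<subseteq> carrier (mpoly_ring n :: 'a mpoly ring)"
        using sub by (simp add: carrier_eq_supported)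
      show "supported S \<noteq> ({} :: 'a mpoly set)"
        by (auto simp: supported_def intro: exI[of _ 0])
    next
      fix p :: "'a mpoly" assume p: "p \<in> supported S"
      then have "\<ominus>\<^bsub>mpoly_ring n\<^esub> p = - p"
        using sub supported_uminus[OF p] by (intro minus_equality) (auto simp: carrier_eq_supported)
      then show "\<ominus>\<^bsub>mpoly_ring n\<^esub> p \<in> supported S"
        using supported_uminus[OF p] by simp
    qed (simp add: supported_add)
  next
    fix p q :: "'a mpoly" assume "p \<in> supported S" "q \<in> carrier (mpoly_ring n)"
    then have "q * p \<in> supported S"
      by (auto simp: carrier_eq_supported intro: supported_mult[OF assms])
    then show "q \<otimes>\<^bsub>mpoly_ring n\<^esub> p \<in> supported S" "p \<otimes>\<^bsub>mpoly_ring n\<^esub> q \<in> supported S"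
      by (simp_all add: mult.commute)
  qed
qed

section \<open>Sums, monomial multiples and generators of monomial ideals\<close>

definition restrict_support :: "(nat \<Rightarrow>\<^sub>0 nat) set \<Rightarrow> ('a :: zero) mpoly \<Rightarrow> 'a mpoly" where
  "restrict_support S p = Poly_Mapping.mapp (\<lambda>m c. if m \<in> S then c else 0) p"

lemma lookup_restrict_support:
  "Poly_Mapping.lookup (restrict_support S p) m = (if m \<in> S then Poly_Mapping.lookup p m else 0)"
  by (auto simp: restrict_support_def lookup_mapp when_def in_keys_iff)

lemma set_add_supported:
  "supported S <+>\<^bsub>mpoly_ring n\<^esub> supported T = (supported (S \<union> T) :: ('a :: comm_ring_1) mpoly set)"
proof
  show "supported S <+>\<^bsub>mpoly_ring n\<^esub> supported T \<subseteq> (supported (S \<union> T) :: 'a mpoly set)"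
    using keys_add by (fastforce simp: set_add_def' supported_def)
  show "supported (S \<union> T) \<subseteq> supported S <+>\<^bsub>mpoly_ring n\<^esub> (supported T :: 'a mpoly set)"
  proof
    fix p :: "'a mpoly" assume p: "p \<in> supported (S \<union> T)"
    have "p = restrict_support S p + restrict_support (- S) p"
      by (rule poly_mapping_eqI) (simp add: lookup_add lookup_restrict_support)
    moreover have "restrict_support S p \<in> supported S" "restrict_support (- S) p \<in> supported T"
      using p by (auto simp: supported_def in_keys_iff lookup_restrict_support split: if_splits)
    ultimately show "p \<in> supported S <+>\<^bsub>mpoly_ring n\<^esub> supported T"
      by (auto simp: set_add_def')
  qed
qed

lemma lookup_single_mult:
  fixes c :: "nat \<Rightarrow>\<^sub>0 nat" and p :: "('a :: comm_ring_1) mpoly"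
  shows "Poly_Mapping.lookup (Poly_Mapping.single c a * p) (c + m) = a * Poly_Mapping.lookup p m"
  by (simp add: lookup_mult lookup_single when_mult)

lemma monomial_expansion:
  "p = (\<Sum>m\<in>Poly_Mapping.keys p. Poly_Mapping.single m (Poly_Mapping.lookup p m))"
  by (rule poly_mapping_eqI) (simp add: lookup_sum lookup_single when_def in_keys_iff)

lemma l_coset_supported:
  fixes c :: "nat \<Rightarrow>\<^sub>0 nat"
  shows "Poly_Mapping.single c 1 <#\<^bsub>mpoly_ring n\<^esub> supported S
    = (supported ((+) c ` S) :: ('a :: comm_ring_1) mpoly set)"
proof
  show "Poly_Mapping.single c 1 <#\<^bsub>mpoly_ring n\<^esub> supported S \<subseteq> (supported ((+) c ` S) :: 'a mpoly set)"
  proof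
    fix q :: "'a mpoly" assume "q \<in> Poly_Mapping.single c 1 <#\<^bsub>mpoly_ring n\<^esub> supported S"
    then obtain p where "p \<in> supported S" "q = Poly_Mapping.single c 1 * p"
      by (auto simp: l_coset_def)
    then show "q \<in> supported ((+) c ` S)"
      using keys_mult[of "Poly_Mapping.single c (1::'a)" p] by (fastforce simp: supported_def)
  qed
  show "supported ((+) c ` S) \<subseteq> Poly_Mapping.single c 1 <#\<^bsub>mpoly_ring n\<^esub> (supported S :: 'a mpoly set)"
  proof
    fix q :: "'a mpoly" assume q: "q \<in> supported ((+) c ` S)"
    \<comment> \<open>The quotient of \<open>q\<close> by the monomial \<open>c\<close>. The
      truncated \<open>m - c\<close> is exact because every monomial of \<open>q\<close> lies in
      \<open>c + S\<close>.\<close>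
    define p where "p = (\<Sum>m\<in>Poly_Mapping.keys q. Poly_Mapping.single (m - c) (Poly_Mapping.lookup q m))"
    have mc: "c + (m - c) = m \<and> m - c \<in> S" if "m \<in> Poly_Mapping.keys q" for m
      using that q by (auto simp: supported_def)
    have "p \<in> supported S"
      unfolding p_def by (intro supported_sum) (use mc in \<open>auto simp: supported_def split: if_splits\<close>)
    moreover have "Poly_Mapping.single c 1 * p = q"
      unfolding p_def sum_distrib_left by (subst (3) monomial_expansion) (auto simp: mult_single mc)
    ultimately show "q \<in> Poly_Mapping.single c 1 <#\<^bsub>mpoly_ring n\<^esub> supported S"
      by (force simp: l_coset_def)
  qed
qed

text \<open>One inclusion is minimality of the generated ideal, as the multiples of \<open>G\<close>
  are upward closed; for the other, every single term of a polynomial supported on them is a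
  multiple of a generator.\<close>

lemma genideal_monomials:
  assumes G: "G \<subseteq> monomials n"
  shows "Idl\<^bsub>mpoly_ring n\<^esub> ((\<lambda>m. Poly_Mapping.single m 1) ` G)
    = (supported {a + g |a g. a \<in> monomials n \<and> g \<in> G} :: ('a :: comm_ring_1) mpoly set)"
    (is "?I = supported ?S")
proof
  interpret cring "mpoly_ring n :: 'a mpoly ring" by (rule cring_mpoly_ring)
  have G': "(\<lambda>m. Poly_Mapping.single m 1) ` G \<subseteq> carrier (mpoly_ring n :: 'a mpoly ring)"
    using G by (auto simp: carrier_eq_supported supported_def)
  interpret I: ideal ?I "mpoly_ring n" by (rule genideal_ideal[OF G'])
  have "up_closed n ?S"
    using G unfolding up_closed_def by (auto simp: add.assoc[symmetric]) (metis add_mem_monomials)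
  then have "ideal (supported ?S) (mpoly_ring n :: 'a mpoly ring)" by (rule ideal_supported)
  moreover have "(\<lambda>m. Poly_Mapping.single m 1) ` G \<subseteq> (supported ?S :: 'a mpoly set)"
    by (force simp: supported_def mem_monomials_lookup intro: exI[of _ 0])
  ultimately show "?I \<subseteq> supported ?S" by (rule genideal_minimal)
  show "supported ?S \<subseteq> ?I"
  proof
    fix p :: "'a mpoly" assume p: "p \<in> supported ?S"
    have mono: "Poly_Mapping.single m c \<in> ?I" if m: "m \<in> ?S" for m and c :: 'a
    proof -
      from m obtain a g where a: "m = a + g" "a \<in> monomials n" "g \<in> G" by auto
      have "Poly_Mapping.single a c \<otimes>\<^bsub>mpoly_ring n\<^esub> Poly_Mapping.single g 1 \<in> ?I"
        using a genideal_self[OF G'] by (intro I.I_l_closed) (auto simp: carrier_eq_supported supported_def)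
      then show ?thesis by (simp add: a mult_single)
    qed
    have "(\<Sum>m\<in>A. Poly_Mapping.single m (Poly_Mapping.lookup p m)) \<in> ?I"
      if "finite A" "A \<subseteq> ?S" for A
      using that
      by (induction A) (use I.zero_closed I.a_closed mono in auto)
    then show "p \<in> ?I"
      using p monomial_expansion[of p] by (metis (no_types, lifting) finite_keys mem_Collect_eq supported_def)
  qed
qed

lemma var_power: "var j ^ e = Poly_Mapping.single (Poly_Mapping.single j e) (1 :: 'a :: comm_ring_1)"
proof (induction e)
  case (Suc e)
  then show ?case
    by (simp add: var_def mult_single single_add[symmetric])
qed simp

lemma prod_var_power:
  "(\<Prod>j\<in>A. var j ^ e j) = Poly_Mapping.single (\<Sum>j\<in>A. Poly_Mapping.single j (e j)) (1 :: 'a :: comm_ring_1)"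
  by (induction A rule: infinite_finite_induct) (auto simp: var_power mult_single)

lemma genideal_var_powers:
  assumes "J \<subseteq> {1..n}"
  shows "Idl\<^bsub>mpoly_ring n\<^esub> ((\<lambda>j. var j ^ e j) ` J)
    = (supported {m \<in> monomials n. \<exists>j\<in>J. e j \<le> Poly_Mapping.lookup m j} :: ('a :: comm_ring_1) mpoly set)"
proof -
  have "(\<lambda>j. var j ^ e j) ` J = (\<lambda>m. Poly_Mapping.single m (1::'a)) ` (\<lambda>j. Poly_Mapping.single j (e j)) ` J"
    by (simp add: image_image var_power)
  moreover have "{a + g |a g. a \<in> monomials n \<and> g \<in> (\<lambda>j. Poly_Mapping.single j (e j)) ` J}
      = {m \<in> monomials n. \<exists>j\<in>J. e j \<le> Poly_Mapping.lookup m j}"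
  proof (intro equalityI subsetI)
    fix m assume "m \<in> {m \<in> monomials n. \<exists>j\<in>J. e j \<le> Poly_Mapping.lookup m j}"
    then obtain j where j: "m \<in> monomials n" "j \<in> J" "e j \<le> Poly_Mapping.lookup m j" by auto
    have "m = m - Poly_Mapping.single j (e j) + Poly_Mapping.single j (e j)"
      by (rule poly_mapping_eqI) (use j in \<open>auto simp: lookup_add lookup_minus lookup_single when_def\<close>)
    with j minus_mem_monomials[OF j(1)]
    show "m \<in> {a + g |a g. a \<in> monomials n \<and> g \<in> (\<lambda>j. Poly_Mapping.single j (e j)) ` J}" by blast
  qed (use assms in \<open>auto simp: single_mem_monomials subset_iff lookup_add intro!: bexI\<close>)
  moreover have "(\<lambda>j. Poly_Mapping.single j (e j)) ` J \<subseteq> monomials n"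
    using assms by (auto simp: single_mem_monomials subset_iff)
  ultimately show ?thesis by (simp only: genideal_monomials)
qed

section \<open>Multiplication by the sum of the variables\<close>

definition linear_form :: "nat \<Rightarrow> ('a :: comm_ring_1) mpoly" where
  "linear_form n = (\<Sum>j=1..n. var j)"

lemma linear_form_supported: "linear_form n \<in> supported (monomials n)"
  unfolding linear_form_def
  by (intro supported_sum) (auto simp: var_def supported_def single_mem_monomials)

lemma homogeneous_linear_form: "homogeneous 1 (linear_form n)"
  using keys_sum[of var "{1..n}"] unfolding linear_form_def homogeneous_def
  by (fastforce simp: var_def split: if_splits)

lemma homogeneous_mult: "homogeneous i p \<Longrightarrow> homogeneous j q \<Longrightarrow> homogeneous (i + j) (p * q)"
  using keys_mult[of p q] unfolding homogeneous_def by (fastforce simp: mon_degree_add)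

lemma homogeneous_power_mult:
  "homogeneous 1 l \<Longrightarrow> homogeneous i p \<Longrightarrow> homogeneous (i + k) (l ^ k * p)"
  by (induction k) (use homogeneous_mult[of 1 l] in \<open>auto simp: mult.assoc\<close>)

lemma homogeneous_diff: "homogeneous i p \<Longrightarrow> homogeneous i q \<Longrightarrow> homogeneous i (p - q)"
  unfolding homogeneous_def by (auto simp: in_keys_iff lookup_minus)

lemma lookup_var_mult:
  "Poly_Mapping.lookup (var j * p) m =
    (if 0 < Poly_Mapping.lookup m j then Poly_Mapping.lookup p (m - Poly_Mapping.single j 1) else 0)"
proof (cases "0 < Poly_Mapping.lookup m j")
  case True
  then show ?thesis
    using lookup_single_mult[of "Poly_Mapping.single j 1" 1 p "m - Poly_Mapping.single j 1"]
    by (simp only: minus_single_add_single[OF True] add.commute[of "Poly_Mapping.single j 1"] var_def mult_1 if_True)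
next
  case False
  then have "m \<notin> Poly_Mapping.keys (var j * p)"
    using keys_mult[of "var j" p] by (auto simp: var_def lookup_add)
  with False show ?thesis by (simp add: in_keys_iff)
qed

lemma lookup_linear_form_mult:
  "Poly_Mapping.lookup (linear_form n * p) m = (\<Sum>j=1..n. if 0 < Poly_Mapping.lookup m j
     then Poly_Mapping.lookup p (m - Poly_Mapping.single j 1) else 0)"
  unfolding linear_form_def sum_distrib_right lookup_sum lookup_var_mult by simp

text \<open>Reading off the coefficients on the box amounts to passing to the subquotient of
  \<open>supported U\<close> by \<open>supported U'\<close>, on which \<open>linear_form n\<close>
  acts as \<open>box_raise\<close>. The box result then shows that \<open>p\<close> has no monomial
  in \<open>U - U'\<close>.\<close>

lemma linear_form_power_injective_box:
  fixes p :: "('k :: field_char_0) mpoly"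
  assumes U: "up_closed n U" and U': "up_closed n U'" and B: "U - U' = box {1..n} u v"
    and r: "r = (\<Sum>j=1..n. int (u j) + int (v j) - 1)"
    and p: "p \<in> supported U" "homogeneous i p" and k: "2 * int i + int k \<le> r"
    and lp: "linear_form n ^ k * p \<in> supported U'"
  shows "p \<in> supported U'"
proof -
  let ?B = "box {1..n} u v"
  define coeffs where "coeffs q m = (if m \<in> ?B then Poly_Mapping.lookup q m else 0)" for q :: "'k mpoly" and m
  have step: "coeffs (linear_form n * q) = box_raise {1..n} u v (coeffs q)" if q: "q \<in> supported U" for q
  proof
    fix m
    show "coeffs (linear_form n * q) m = box_raise {1..n} u v (coeffs q) m"
    proof (cases "m \<in> ?B")
      case True
      have "(if 0 < Poly_Mapping.lookup m j then Poly_Mapping.lookup q (m - Poly_Mapping.single j 1) else 0) =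
        (if u j < Poly_Mapping.lookup m j then coeffs q (m - Poly_Mapping.single j 1) else 0)"
        if j: "j \<in> {1..n}" for j
      proof (cases "0 < Poly_Mapping.lookup m j \<and> \<not> u j < Poly_Mapping.lookup m j")
        case True
        let ?m = "m - Poly_Mapping.single j 1"
        have "?m \<notin> ?B"
          using minus_single_mem_box[OF \<open>m \<in> ?B\<close> j] True by (simp del: One_nat_def)
        \<comment> \<open>This predecessor of \<open>m\<close> has left the box at its lower end. It
          cannot lie in \<open>U'\<close>, since then \<open>m\<close> would too; so it lies outside
          \<open>U\<close> and contributes nothing.\<close>
        moreover have "?m \<notin> U'"
        proof
          assume "?m \<in> U'"
          then have "Poly_Mapping.single j 1 + ?m \<in> U'"
            using U' single_mem_monomials[OF j] by (auto simp: up_closed_def)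
          then have "m \<in> U'"
            using minus_single_add_single[of m j] True by (metis add.commute)
          then show False using \<open>m \<in> ?B\<close> B by blast
        qed
        ultimately have "?m \<notin> U" using B by blast
        then have "Poly_Mapping.lookup q ?m = 0"
          using q by (auto simp: supported_def in_keys_iff)
        with True show ?thesis by simp
      qed (use minus_single_mem_box[OF True j] in \<open>auto simp: coeffs_def\<close>)
      with True show ?thesis
        unfolding coeffs_def[of "linear_form n * q"] lookup_linear_form_mult box_raise_def
        by (auto intro!: sum.cong)
    qed (simp add: coeffs_def box_raise_def)
  qed
  have pow: "coeffs (linear_form n ^ k * p) = (box_raise {1..n} u v ^^ k) (coeffs p)" for k
  proof (induction k)
    case (Suc k)
    have "linear_form n ^ k * p \<in> supported U"
      by (rule supported_power_mult[OF U linear_form_supported p(1)])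
    from step[OF this] Suc show ?case by (simp add: mult.assoc)
  qed simp
  have "(box_raise {1..n} u v ^^ k) (coeffs p) = (\<lambda>_. 0)"
    using lp B unfolding pow[symmetric] by (auto simp: coeffs_def fun_eq_iff supported_def in_keys_iff)
  moreover have "coeffs p \<in> box_graded ?B i"
    using p by (auto simp: coeffs_def box_graded_def homogeneous_def in_keys_iff)
  ultimately have "coeffs p = (\<lambda>_. 0)"
    using box_raise_injective[OF _ r _ k] by blast
  then have "Poly_Mapping.keys p \<inter> ?B = {}"
    by (auto simp: coeffs_def fun_eq_iff in_keys_iff split: if_splits)
  then show ?thesis using p(1) B by (auto simp: supported_def)
qed

section \<open>Multiplication maps between finite-dimensional subspaces\<close>

context cring
begin

lemma Span_map_mult:
  assumes "F \<subseteq> carrier R" "a \<in> carrier R" "set Us \<subseteq> carrier R"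
  shows "Span F (map (\<lambda>x. a \<otimes> x) Us) = (\<lambda>x. a \<otimes> x) ` Span F Us"
  using assms(3)
proof (induction Us)
  case (Cons u Us)
  then have u: "u \<in> carrier R" and Us: "set Us \<subseteq> carrier R" by auto
  have "\<exists>v. v \<in> line_extension F u (Span F Us) \<and> x = a \<otimes> v"
    if x: "x \<in> line_extension F (a \<otimes> u) ((\<lambda>x. a \<otimes> x) ` Span F Us)" for x
  proof -
    from x obtain k v where k: "k \<in> F" "v \<in> Span F Us" "x = k \<otimes> (a \<otimes> u) \<oplus> a \<otimes> v"
      by (auto simp: line_extension_mem_iff)
    have "k \<in> carrier R" "v \<in> carrier R"
      using k assms Span_in_carrier[OF assms(1) Us] by blast+
    then have "x = a \<otimes> (k \<otimes> u \<oplus> v)"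
      using k u assms(2) by (simp add: r_distr m_lcomm)
    with k show ?thesis by (metis line_extension_mem_iff)
  qed
  moreover have "a \<otimes> v \<in> line_extension F (a \<otimes> u) ((\<lambda>x. a \<otimes> x) ` Span F Us)"
    if v: "v \<in> line_extension F u (Span F Us)" for v
  proof -
    from v obtain k w where k: "k \<in> F" "w \<in> Span F Us" "v = k \<otimes> u \<oplus> w"
      by (auto simp: line_extension_mem_iff)
    have "k \<in> carrier R" "w \<in> carrier R"
      using k assms Span_in_carrier[OF assms(1) Us] by blast+
    then have "a \<otimes> v = k \<otimes> (a \<otimes> u) \<oplus> a \<otimes> w"
      using k u assms(2) by (simp add: r_distr m_lcomm)
    with k show ?thesis by (auto simp: line_extension_mem_iff)
  qed
  ultimately show ?case
    using Cons.IH[OF Us] by auto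
qed (use assms in auto)

lemma independent_map_mult:
  assumes "subfield F R" "a \<in> carrier R" "independent F Us" "inj_on (\<lambda>x. a \<otimes> x) (Span F Us)"
  shows "independent F (map (\<lambda>x. a \<otimes> x) Us)"
  using assms(3,4)
proof (induction Us rule: list.induct)
  case (Cons u Us)
  note F = subfieldE(3)[OF assms(1)]
  from Cons.prems(1) have u: "u \<in> carrier R" "u \<notin> Span F Us" "independent F Us"
    by (auto elim: independent.cases)
  have Us: "set (u # Us) \<subseteq> carrier R" by (rule independent_in_carrier[OF Cons.prems(1)])
  have sub: "u \<in> Span F (u # Us)" "Span F Us \<subseteq> Span F (u # Us)"
    using Span_base_incl[OF assms(1) Us] mono_Span[OF assms(1) _ u(1)] Us by auto
  have "a \<otimes> u \<notin> (\<lambda>x. a \<otimes> x) ` Span F Us"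
    using inj_onD[OF Cons.prems(2)] sub u(2) by blast
  moreover have "independent F (map (\<lambda>x. a \<otimes> x) Us)"
    using Cons.IH u(3) inj_on_subset[OF Cons.prems(2) sub(2)] by blast
  ultimately show ?case
    using u(1) assms(2) Us Span_map_mult[OF F assms(2), of Us] by (auto intro!: li_Cons)
qed simp

text \<open>An injective multiplication carries a basis of \<open>A\<close> to \<open>k\<close>
  independent elements of \<open>B\<close>, which therefore span \<open>B\<close>.\<close>

lemma mult_inj_imp_surj:
  assumes F: "subfield F R" and a: "a \<in> carrier R"
    and dim: "dimension k F A" "dimension k F B" and sub: "(\<lambda>x. a \<otimes> x) ` A \<subseteq> B"
    and inj: "inj_on (\<lambda>x. a \<otimes> x) A"
  shows "(\<lambda>x. a \<otimes> x) ` A = B"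
proof -
  from exists_base[OF F dim(1)] obtain Us
    where Us: "set Us \<subseteq> carrier R" "independent F Us" "length Us = k" "Span F Us = A" by blast
  let ?Vs = "map (\<lambda>x. a \<otimes> x) Us"
  have "independent F ?Vs" using independent_map_mult[OF F a Us(2)] inj Us(4) by (simp del: Span.simps)
  moreover have "set ?Vs \<subseteq> B" using Span_base_incl[OF F Us(1)] Us(4) sub by auto
  ultimately have "Span F ?Vs = B"
    using independent_length_eq_dimension[OF F dim(2)] Us(3) length_map by metis
  then show ?thesis using Span_map_mult[OF subfieldE(3)[OF F] a Us(1)] Us(4) by (simp del: Span.simps)
qed

end

section \<open>Quotients by monomial ideals\<close>

definition degree_slice :: "(nat \<Rightarrow>\<^sub>0 nat) set \<Rightarrow> nat \<Rightarrow> (nat \<Rightarrow>\<^sub>0 nat) set" where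
  "degree_slice S i = {m \<in> S. mon_degree m = i}"

lemma lookup_le_mon_degree: "Poly_Mapping.lookup m j \<le> mon_degree m"
  unfolding mon_degree_def by (cases "j \<in> Poly_Mapping.keys m") (auto simp: in_keys_iff intro: member_le_sum)

lemma finite_degree_slice:
  assumes "S \<subseteq> monomials n"
  shows "finite (degree_slice S i)"
proof (rule inj_on_finite)
  show "inj_on Poly_Mapping.lookup (degree_slice S i)"
    by (intro inj_onI poly_mapping_eqI) simp
  show "Poly_Mapping.lookup ` degree_slice S i \<subseteq>
      {f. \<forall>j. (j \<in> {1..n} \<longrightarrow> f j \<in> {..i}) \<and> (j \<notin> {1..n} \<longrightarrow> f j = 0)}"
  proof (rule image_subsetI)
    fix m assume "m \<in> degree_slice S i"
    with assms have "m \<in> monomials n" "mon_degree m = i" by (auto simp: degree_slice_def)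
    then show "Poly_Mapping.lookup m \<in>
        {f. \<forall>j. (j \<in> {1..n} \<longrightarrow> f j \<in> {..i}) \<and> (j \<notin> {1..n} \<longrightarrow> f j = 0)}"
      using lookup_le_mon_degree[of m] by (simp add: mem_monomials_lookup)
  qed
qed (intro finite_set_of_finite_funs; simp)

locale monomial_quotient =
  fixes n :: nat and S :: "(nat \<Rightarrow>\<^sub>0 nat) set" and K :: "('k :: field) mpoly set"
  assumes up_closed: "up_closed n S" and K: "K = supported S"
begin

abbreviation "P \<equiv> (mpoly_ring n :: 'k mpoly ring)"
abbreviation "Q \<equiv> P Quot K"
abbreviation "cl p \<equiv> K +>\<^bsub>P\<^esub> p"
abbreviation "N \<equiv> monomials n - S"

lemma ideal_K: "ideal K P" unfolding K by (rule ideal_supported[OF up_closed])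

sublocale P: cring P by (rule cring_mpoly_ring)
sublocale Q: cring Q by (rule ideal.quotient_is_cring[OF ideal_K cring_mpoly_ring])
sublocale h: ring_hom_ring P Q "\<lambda>p. cl p" by (rule ideal.rcos_ring_hom_ring[OF ideal_K])

lemma cl_eq_iff:
  assumes "p \<in> supported (monomials n)" "q \<in> supported (monomials n)"
  shows "cl p = cl q \<longleftrightarrow> p - q \<in> K"
proof -
  have "\<ominus>\<^bsub>P\<^esub> q = - q"
    using supported_uminus[OF assms(2)] assms(2) by (intro P.minus_equality) (auto simp: carrier_eq_supported)
  then show ?thesis
    using P.quotient_eq_iff_same_a_r_cos[OF ideal_K, of p q] assms
    by (simp add: carrier_eq_supported a_minus_def)
qed

lemma cl_closed: "p \<in> supported (monomials n) \<Longrightarrow> cl p \<in> carrier Q"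
  using h.hom_closed by (simp add: carrier_eq_supported)

lemma cl_add: "p \<in> supported (monomials n) \<Longrightarrow> q \<in> supported (monomials n) \<Longrightarrow> cl p \<oplus>\<^bsub>Q\<^esub> cl q = cl (p + q)"
  using h.hom_add[of p q] by (simp add: carrier_eq_supported)

lemma cl_mult: "p \<in> supported (monomials n) \<Longrightarrow> q \<in> supported (monomials n) \<Longrightarrow> cl p \<otimes>\<^bsub>Q\<^esub> cl q = cl (p * q)"
  using h.hom_mult[of p q] by (simp add: carrier_eq_supported)

lemma cl_zero: "cl 0 = \<zero>\<^bsub>Q\<^esub>"
  using h.hom_zero by simp

lemma cl_power:
  assumes "p \<in> supported (monomials n)"
  shows "cl p [^]\<^bsub>Q\<^esub> (k::nat) = cl (p ^ k)"
proof (induction k)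
  case 0
  show ?case using h.hom_one by simp
next
  case (Suc k)
  have "p ^ k * 1 \<in> supported (monomials n)"
    using assms by (intro supported_power_mult[OF up_closed_monomials])
      (auto simp: supported_def mem_monomials_lookup)
  with Suc assms show ?case by (simp add: cl_mult mult.commute)
qed

lemma supported_mono: "A \<subseteq> B \<Longrightarrow> p \<in> supported A \<Longrightarrow> p \<in> supported B"
  by (auto simp: supported_def)

lemma Span_monomials:
  assumes "set ms \<subseteq> monomials n"
  shows "Q.Span (quot_scalars n K) (map (\<lambda>m. cl (Poly_Mapping.single m 1)) ms) = (\<lambda>p. cl p) ` supported (set ms)"
  using assms
proof (induction ms)
  case Nil
  have "supported {} = {0 :: 'k mpoly}" by (auto simp: supported_def)
  then show ?case by (simp add: cl_zero)
next
  case (Cons m ms)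
  let ?u = "cl (Poly_Mapping.single m 1)"
  have ext: "cl (const c) \<otimes>\<^bsub>Q\<^esub> ?u \<oplus>\<^bsub>Q\<^esub> cl p = cl (Poly_Mapping.single m c + p)"
    if "p \<in> supported (set ms)" for c p
  proof -
    have "const c \<in> supported (monomials n)" "Poly_Mapping.single m d \<in> supported (monomials n)"
        "p \<in> supported (monomials n)" for d :: 'k
      using Cons.prems that by (auto simp: supported_def const_def mem_monomials_lookup)
    then show ?thesis by (simp add: cl_add cl_mult const_def mult_single)
  qed
  have "x \<in> Q.line_extension (quot_scalars n K) ?u ((\<lambda>p. cl p) ` supported (set ms))
      \<longleftrightarrow> x \<in> (\<lambda>p. cl p) ` supported (insert m (set ms))" for x
  proof
    assume "x \<in> Q.line_extension (quot_scalars n K) ?u ((\<lambda>p. cl p) ` supported (set ms))"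
    then obtain c p where p: "p \<in> supported (set ms)" "x = cl (const c) \<otimes>\<^bsub>Q\<^esub> ?u \<oplus>\<^bsub>Q\<^esub> cl p"
      by (auto simp: Q.line_extension_mem_iff quot_scalars_def)
    have "Poly_Mapping.single m c + p \<in> supported (insert m (set ms))"
      by (rule supported_add) (use p in \<open>auto simp: supported_def\<close>)
    with p ext show "x \<in> (\<lambda>p. cl p) ` supported (insert m (set ms))" by auto
  next
    assume "x \<in> (\<lambda>p. cl p) ` supported (insert m (set ms))"
    then obtain q where q: "q \<in> supported (insert m (set ms))" "x = cl q" by auto
    have "q = Poly_Mapping.single m (Poly_Mapping.lookup q m) + restrict_support (- {m}) q"
      by (rule poly_mapping_eqI) (simp add: lookup_add lookup_single lookup_restrict_support when_def)
    moreover have p: "restrict_support (- {m}) q \<in> supported (set ms)"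
      using q by (auto simp: supported_def in_keys_iff lookup_restrict_support split: if_splits)
    ultimately have "x = cl (const (Poly_Mapping.lookup q m)) \<otimes>\<^bsub>Q\<^esub> ?u \<oplus>\<^bsub>Q\<^esub> cl (restrict_support (- {m}) q)"
      using q(2) ext by metis
    with p show "x \<in> Q.line_extension (quot_scalars n K) ?u ((\<lambda>p. cl p) ` supported (set ms))"
      by (auto simp: Q.line_extension_mem_iff quot_scalars_def)
  qed
  with Cons show ?case by auto
qed

text \<open>A relation would put into \<open>K\<close> a polynomial whose coefficient at
  \<open>m\<close> is 1, although \<open>m\<close> is not in \<open>S\<close>.\<close>

lemma independent_monomials:
  assumes "set ms \<subseteq> N" "distinct ms"
  shows "Q.independent (quot_scalars n K) (map (\<lambda>m. cl (Poly_Mapping.single m 1)) ms)"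
  using assms
proof (induction ms)
  case (Cons m ms)
  have m: "Poly_Mapping.single m 1 \<in> supported (monomials n)"
    using Cons.prems by (auto simp: supported_def)
  have "cl (Poly_Mapping.single m 1) \<noteq> cl p" if p: "p \<in> supported (set ms)" for p
  proof
    assume "cl (Poly_Mapping.single m 1) = cl p"
    moreover have "p \<in> supported (monomials n)"
      by (rule supported_mono[OF _ p]) (use Cons.prems in auto)
    ultimately have "Poly_Mapping.single m 1 - p \<in> supported S"
      using m cl_eq_iff K by blast
    moreover have "Poly_Mapping.lookup p m = 0"
      using p Cons.prems(2) by (auto simp: supported_def in_keys_iff)
    then have "m \<in> Poly_Mapping.keys (Poly_Mapping.single m 1 - p)"
      by (simp add: in_keys_iff lookup_minus)
    ultimately show False using Cons.prems(1) by (auto simp: supported_def)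
  qed
  then have "cl (Poly_Mapping.single m 1) \<notin> (\<lambda>p. cl p) ` supported (set ms)" by blast
  moreover have "set ms \<subseteq> monomials n" using Cons.prems by auto
  ultimately show ?case
    using Cons cl_closed[OF m] Span_monomials[of ms] by (auto intro!: Q.li_Cons simp del: Q.Span.simps)
qed simp

text \<open>Deleting all terms in \<open>S\<close> keeps a polynomial homogeneous and changes it by
  an element of \<open>K\<close> only.\<close>

lemma quot_component_eq: "quot_component n K i = (\<lambda>p. cl p) ` supported (degree_slice N i)"
proof (intro equalityI subsetI)
  fix x assume "x \<in> quot_component n K i"
  then obtain p where p: "p \<in> supported (monomials n)" "homogeneous i p" "x = cl p"
    by (auto simp: quot_component_def carrier_eq_supported)
  let ?q = "restrict_support (- S) p"
  have q: "?q \<in> supported (degree_slice N i)"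
    using p by (auto simp: supported_def in_keys_iff lookup_restrict_support degree_slice_def
        homogeneous_def split: if_splits)
  then have "?q \<in> supported (monomials n)"
    by (rule supported_mono[rotated]) (auto simp: degree_slice_def)
  moreover have "p - ?q \<in> K"
    by (auto simp: K supported_def in_keys_iff lookup_restrict_support lookup_minus split: if_splits)
  ultimately have "x = cl ?q" using p cl_eq_iff by simp
  with q show "x \<in> (\<lambda>p. cl p) ` supported (degree_slice N i)" by blast
next
  fix x assume "x \<in> (\<lambda>p. cl p) ` supported (degree_slice N i)"
  then obtain p where "p \<in> supported (degree_slice N i)" "x = cl p" by auto
  moreover from this have "p \<in> supported (monomials n)" "homogeneous i p"
    by (auto simp: supported_def homogeneous_def degree_slice_def)
  ultimately show "x \<in> quot_component n K i"
    by (auto simp: quot_component_def carrier_eq_supported)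
qed

text \<open>The classes of the standard monomials of degree \<open>i\<close> form a basis. This
  includes the zero quotient, where the scalars are no field but the basis is empty.\<close>

lemma dimension_quot_component:
  "Q.dimension (card (degree_slice N i)) (quot_scalars n K) (quot_component n K i)"
proof -
  have fin: "finite (degree_slice N i)" by (rule finite_degree_slice[of _ n]) auto
  obtain ms where ms: "set ms = degree_slice N i" "distinct ms"
    using finite_distinct_list[OF fin] by blast
  have N: "set ms \<subseteq> N" "set ms \<subseteq> monomials n" using ms(1) by (auto simp: degree_slice_def)
  have len: "length ms = card (degree_slice N i)" using distinct_card[OF ms(2)] ms(1) by simp
  from Q.dimension_independent[OF independent_monomials[OF N(1) ms(2)]] show ?thesis
    by (simp only: Span_monomials[OF N(2)] length_map len ms(1) quot_component_eq)
qed

lemma quot_component_zero_iff: "quot_component n K i = {\<zero>\<^bsub>Q\<^esub>} \<longleftrightarrow> degree_slice N i = {}"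
proof
  assume "degree_slice N i = {}"
  then have "Q.dimension 0 (quot_scalars n K) (quot_component n K i)"
    using dimension_quot_component[of i] by simp
  then show "quot_component n K i = {\<zero>\<^bsub>Q\<^esub>}" by (auto elim: Q.dimension.cases)
next
  assume 0: "quot_component n K i = {\<zero>\<^bsub>Q\<^esub>}"
  show "degree_slice N i = {}"
  proof (rule equals0I)
    fix m assume m: "m \<in> degree_slice N i"
    let ?p = "Poly_Mapping.single m (1 :: 'k)"
    have "?p \<in> supported (degree_slice N i)" using m by (auto simp: supported_def)
    then have "cl ?p = cl 0" using 0 unfolding quot_component_eq by (auto simp: cl_zero)
    moreover have "?p \<in> supported (monomials n)" "0 \<in> supported (monomials n)"
      using m by (auto simp: supported_def degree_slice_def)
    ultimately have "?p - 0 \<in> supported S" using cl_eq_iff K by blast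
    with m show False by (simp add: supported_def degree_slice_def)
  qed
qed

end

section \<open>From injectivity and symmetry to the strong Lefschetz property\<close>

context monomial_quotient
begin

text \<open>Between degrees with sum \<open>r\<close>, injectivity and equal dimensions give
  bijectivity. Every map that lands beyond the mirror image of its source degree, but not above
  \<open>r\<close>, is the last factor of such a bijection, hence surjective.\<close>

lemma lefschetz_of_injective:
  fixes r :: int
  assumes inj: "\<And>i k p. p \<in> supported (monomials n) \<Longrightarrow> homogeneous i p \<Longrightarrow> 2 * int i + int k \<le> r
      \<Longrightarrow> linear_form n ^ k * p \<in> K \<Longrightarrow> p \<in> K"
    and sym: "\<And>i j. int i + int j = r \<Longrightarrow> card (degree_slice N i) = card (degree_slice N j)"
    and bound: "\<And>m. m \<in> N \<Longrightarrow> int (mon_degree m) \<le> r"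
  shows "strong_lefschetz_narrow Q (quot_scalars n K) (quot_component n K)"
    and "K \<noteq> carrier P \<Longrightarrow> \<exists>t. max_socle_degree Q (quot_component n K) t \<and> int t = r"
proof -
  let ?A = "quot_component n K" and ?F = "quot_scalars n K"
  let ?l = "cl (linear_form n)"
  have above: "?A i = {\<zero>\<^bsub>Q\<^esub>}" if "r < int i" for i
    using bound that unfolding quot_component_zero_iff degree_slice_def by fastforce
  have artin: "artinian_graded Q ?F ?A"
    unfolding artinian_graded_def
  proof (intro conjI allI exI impI)
    show "Q.finite_dimension ?F (?A i)" for i
      by (rule Q.finite_dimensionI[OF dimension_quot_component])
    show "?A i = {\<zero>\<^bsub>Q\<^esub>}" if "nat r < i" for i
      using that by (intro above) linarith
  qed
  have lA: "?l \<in> ?A 1"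
    unfolding quot_component_def
    using linear_form_supported homogeneous_linear_form by (auto simp: carrier_eq_supported)
  have A_form: "\<exists>p. p \<in> supported (monomials n) \<and> homogeneous i p \<and> x = cl p" if "x \<in> ?A i" for x i
    using that by (auto simp: quot_component_def carrier_eq_supported)
  have mult_eq: "(?l [^]\<^bsub>Q\<^esub> k) \<otimes>\<^bsub>Q\<^esub> cl p = cl (linear_form n ^ k * p)"
      and lk: "linear_form n ^ k * p \<in> supported (monomials n)"
      if "p \<in> supported (monomials n)" for k :: nat and p :: "'k mpoly"
  proof -
    have "linear_form n ^ k * (1 :: 'k mpoly) \<in> supported (monomials n)"
      using linear_form_supported
      by (intro supported_power_mult[OF up_closed_monomials]) (auto simp: supported_def mem_monomials_lookup)
    then show "(?l [^]\<^bsub>Q\<^esub> k) \<otimes>\<^bsub>Q\<^esub> cl p = cl (linear_form n ^ k * p)"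
      using that by (simp add: cl_power linear_form_supported cl_mult)
    show "linear_form n ^ k * p \<in> supported (monomials n)"
      by (rule supported_power_mult[OF up_closed_monomials linear_form_supported that])
  qed
  have maps: "(?l [^]\<^bsub>Q\<^esub> k) \<otimes>\<^bsub>Q\<^esub> x \<in> ?A (i + k)" if "x \<in> ?A i" for k :: nat and x i
  proof -
    from A_form[OF that] obtain p where p: "p \<in> supported (monomials n)" "homogeneous i p" "x = cl p" by blast
    then have "linear_form n ^ k * p \<in> {q \<in> carrier P. homogeneous (i + k) q}"
      using lk homogeneous_power_mult[OF homogeneous_linear_form] by (simp add: carrier_eq_supported)
    then have "cl (linear_form n ^ k * p) \<in> ?A (i + k)"
      unfolding quot_component_def by (rule imageI)
    then show ?thesis by (simp only: p(3) mult_eq[OF p(1)])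
  qed
  have injA: "inj_on (\<lambda>a. (?l [^]\<^bsub>Q\<^esub> k) \<otimes>\<^bsub>Q\<^esub> a) (?A i)" if "2 * int i + int k \<le> r" for i k :: nat
  proof (rule inj_onI)
    fix x y assume "x \<in> ?A i" "y \<in> ?A i" and eq: "(?l [^]\<^bsub>Q\<^esub> k) \<otimes>\<^bsub>Q\<^esub> x = (?l [^]\<^bsub>Q\<^esub> k) \<otimes>\<^bsub>Q\<^esub> y"
    then obtain p q where p: "p \<in> supported (monomials n)" "homogeneous i p" "x = cl p"
      and q: "q \<in> supported (monomials n)" "homogeneous i q" "y = cl q"
      using A_form by meson
    from eq p q have "linear_form n ^ k * p - linear_form n ^ k * q \<in> K"
      by (simp add: mult_eq cl_eq_iff lk)
    then have "p - q \<in> K"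
      using inj[OF supported_diff[OF p(1) q(1)] homogeneous_diff[OF p(2) q(2)] that]
      by (simp add: right_diff_distrib)
    then show "x = y" using p q by (simp add: cl_eq_iff)
  qed
  have lQ: "?l [^]\<^bsub>Q\<^esub> (k :: nat) \<in> carrier Q" for k
    using cl_closed[OF linear_form_supported] by simp
  have AQ: "?A i \<subseteq> carrier Q" for i using A_form cl_closed by blast
  have surj: "(\<lambda>a. (?l [^]\<^bsub>Q\<^esub> k) \<otimes>\<^bsub>Q\<^esub> a) ` ?A i = ?A (i + k)"
    if k: "\<not> 2 * int i + int k \<le> r" "int (i + k) \<le> r" "K \<noteq> carrier P" for i k :: nat
  proof -
    \<comment> \<open>\<open>j\<close> is the mirror image of the target degree
      \<open>i + k\<close>. As \<open>j <= i\<close>, the bijection from degree \<open>j\<close> to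
      degree \<open>i + k\<close> factors through degree \<open>i\<close>.\<close>
    define j where "j = nat (r - int (i + k))"
    have j: "int j = r - int (i + k)" "j \<le> i" using k by (auto simp: j_def)
    define t where "t = i - j"
    have it: "i = j + t" using j by (simp add: t_def)
    have "(\<lambda>a. (?l [^]\<^bsub>Q\<^esub> (k + t)) \<otimes>\<^bsub>Q\<^esub> a) ` ?A j = ?A (j + (k + t))"
    proof (rule Q.mult_inj_imp_surj[OF subfield_quot_scalars[OF ideal_K k(3)] lQ])
      show "Q.dimension (card (degree_slice N j)) ?F (?A j)" by (rule dimension_quot_component)
      have "card (degree_slice N j) = card (degree_slice N (j + (k + t)))"
        by (rule sym) (use j it in simp)
      then show "Q.dimension (card (degree_slice N j)) ?F (?A (j + (k + t)))"
        using dimension_quot_component by metis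
      show "inj_on (\<lambda>a. (?l [^]\<^bsub>Q\<^esub> (k + t)) \<otimes>\<^bsub>Q\<^esub> a) (?A j)"
        by (rule injA) (use j it in simp)
    qed (use maps in blast)
    moreover have "(\<lambda>a. (?l [^]\<^bsub>Q\<^esub> (k + t)) \<otimes>\<^bsub>Q\<^esub> a) ` ?A j \<subseteq> (\<lambda>a. (?l [^]\<^bsub>Q\<^esub> k) \<otimes>\<^bsub>Q\<^esub> a) ` ?A i"
    proof (rule image_subsetI)
      fix x assume x: "x \<in> ?A j"
      have "(?l [^]\<^bsub>Q\<^esub> (k + t)) \<otimes>\<^bsub>Q\<^esub> x = (?l [^]\<^bsub>Q\<^esub> k) \<otimes>\<^bsub>Q\<^esub> ((?l [^]\<^bsub>Q\<^esub> t) \<otimes>\<^bsub>Q\<^esub> x)"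
        using Q.m_assoc[OF lQ lQ, of x k t] x AQ cl_closed[OF linear_form_supported]
        by (auto simp: Q.nat_pow_mult)
      then show "(?l [^]\<^bsub>Q\<^esub> (k + t)) \<otimes>\<^bsub>Q\<^esub> x \<in> (\<lambda>a. (?l [^]\<^bsub>Q\<^esub> k) \<otimes>\<^bsub>Q\<^esub> a) ` ?A i"
        using maps[OF x, of t] it by auto
    qed
    moreover have "j + (k + t) = i + k" using it by simp
    moreover have "(\<lambda>a. (?l [^]\<^bsub>Q\<^esub> k) \<otimes>\<^bsub>Q\<^esub> a) ` ?A i \<subseteq> ?A (i + k)" using maps by blast
    ultimately show ?thesis by (simp only: subset_antisym)
  qed
  have lef: "strong_lefschetz Q ?A"
    unfolding strong_lefschetz_def
  proof (intro bexI[OF _ lA] allI impI)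
    fix j i :: nat
    \<comment> \<open>The second case has a zero target, so the map is onto. The last case is the
      zero ring, treated apart because there the scalars do not form a field.\<close>
    consider "2 * int i + int j \<le> r" | "r < int (i + j)"
      | "\<not> 2 * int i + int j \<le> r" "int (i + j) \<le> r" "K \<noteq> carrier P" | "K = carrier P" by linarith
    then show "inj_on (\<lambda>a. (?l [^]\<^bsub>Q\<^esub> j) \<otimes>\<^bsub>Q\<^esub> a) (?A i) \<or>
        (\<lambda>a. (?l [^]\<^bsub>Q\<^esub> j) \<otimes>\<^bsub>Q\<^esub> a) ` ?A i = ?A (i + j)"
    proof cases
      case 2
      have "?A i \<noteq> {}" unfolding quot_component_eq by (auto simp: supported_def intro: exI[of _ 0])
      moreover have "(\<lambda>a. (?l [^]\<^bsub>Q\<^esub> j) \<otimes>\<^bsub>Q\<^esub> a) ` ?A i \<subseteq> {\<zero>\<^bsub>Q\<^esub>}"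
        using maps[of _ i j] above[OF 2] by auto
      ultimately show ?thesis using above[OF 2] by auto
    next
      case 4
      then have "cl p = cl 0" if "p \<in> supported (monomials n)" for p
        using that by (subst cl_eq_iff) (auto simp: carrier_eq_supported supported_def)
      then have "inj_on (\<lambda>a. (?l [^]\<^bsub>Q\<^esub> j) \<otimes>\<^bsub>Q\<^esub> a) (?A i)"
        using A_form by (intro inj_onI) metis
      then show ?thesis ..
    qed (use injA surj in auto)
  qed
  have socle: "max_socle_degree Q ?A (nat r) \<and> int (nat r) = r" if "K \<noteq> carrier P"
  proof -
    \<comment> \<open>The class of 1 makes degree 0 nonzero, and symmetry carries this over to
      degree \<open>r\<close>.\<close>
    have "0 \<notin> S"
    proof
      assume "0 \<in> S"
      then have "S = monomials n" using up_closed by (fastforce simp: up_closed_def)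
      with that show False by (simp add: K carrier_eq_supported)
    qed
    then have 0: "0 \<in> degree_slice N 0" by (simp add: degree_slice_def mem_monomials_lookup mon_degree_def)
    then have r: "0 \<le> r" using bound[of 0] by (simp add: degree_slice_def mon_degree_def)
    have "card (degree_slice N 0) = card (degree_slice N (nat r))"
      by (rule sym) (use r in simp)
    moreover have "finite (degree_slice N 0)" by (rule finite_degree_slice[of _ n]) auto
    ultimately have "degree_slice N (nat r) \<noteq> {}" using 0 by (metis card_eq_0_iff empty_iff)
    then show ?thesis
      using r above by (auto simp: max_socle_degree_def quot_component_zero_iff)
  qed
  have "symmetric_hilbert_series Q ?F ?A"
    unfolding symmetric_hilbert_series_def
  proof (intro allI impI)
    fix t i assume t: "max_socle_degree Q ?A t" and i: "i \<le> t"
    \<comment> \<open>In the zero quotient no degree \<open>t\<close> has a nonzero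
      component.\<close>
    have "K \<noteq> carrier P"
    proof
      assume "K = carrier P"
      then have "cl p = cl 0" if "p \<in> supported (monomials n)" for p
        using that by (subst cl_eq_iff) (auto simp: carrier_eq_supported supported_def)
      then have "?A t \<subseteq> {\<zero>\<^bsub>Q\<^esub>}" using A_form cl_zero by blast
      moreover have "?A t \<noteq> {}" unfolding quot_component_eq by (auto simp: supported_def intro: exI[of _ 0])
      ultimately show False using t by (auto simp: max_socle_degree_def)
    qed
    note F = subfield_quot_scalars[OF ideal_K this] and s = socle[OF this]
    have "t = nat r" using t s unfolding max_socle_degree_def by (meson nat_neq_iff)
    with s have "int t = r" by simp
    have "Q.dim ?F (?A j) = card (degree_slice N j)" for j
      using Q.dimI[OF F dimension_quot_component] by (simp add: over_def)
    then show "Q.dim ?F (?A i) = Q.dim ?F (?A (t - i))"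
      using sym[of i "t - i"] \<open>int t = r\<close> i by simp
  qed
  with artin lef show "strong_lefschetz_narrow Q ?F ?A" by (simp add: strong_lefschetz_narrow_def)
  show "\<exists>t. max_socle_degree Q ?A t \<and> int t = r" if "K \<noteq> carrier P" using socle[OF that] by blast
qed

end

section \<open>Chains of monomial ideals with concentric boxes as successive differences\<close>

lemma card_degree_slice_box:
  assumes "int i + int i' = (\<Sum>j\<in>J. int (u j) + int (v j) - 1)" and J: "finite J"
  shows "card (degree_slice (box J u v) i) = card (degree_slice (box J u v) i')"
proof -
  \<comment> \<open>Point reflection of the box in its centre. The truncated subtraction is exact
    inside the box, so \<open>refl\<close> is its own inverse there.\<close>
  define refl where "refl m = (\<Sum>j\<in>J. Poly_Mapping.single j (u j + v j - 1 - Poly_Mapping.lookup m j))" for m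
  have lr: "Poly_Mapping.lookup (refl m) j = (if j \<in> J then u j + v j - 1 - Poly_Mapping.lookup m j else 0)" for m j
    using J by (simp add: refl_def lookup_sum lookup_single when_def)
  have "refl m \<in> box J u v" if "m \<in> box J u v" for m
    using that by (fastforce simp: box_def lr in_keys_iff split: if_splits)
  moreover have "refl (refl m) = m" if "m \<in> box J u v" for m
  proof (rule poly_mapping_eqI)
    fix j
    show "Poly_Mapping.lookup (refl (refl m)) j = Poly_Mapping.lookup m j"
      using that by (cases "j \<in> J") (auto simp: lr box_def in_keys_iff subset_iff)
  qed
  moreover have "int (mon_degree (refl m)) + int (mon_degree m) = int i + int i'" if m: "m \<in> box J u v" for m
  proof -
    have "int (mon_degree (refl m)) + int (mon_degree m) =
        (\<Sum>j\<in>J. int (Poly_Mapping.lookup (refl m) j) + int (Poly_Mapping.lookup m j))"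
      using m J by (subst (1 2) mon_degree_superset[of _ J])
        (auto simp: box_def lr in_keys_iff sum.distrib split: if_splits)
    also have "\<dots> = (\<Sum>j\<in>J. int (u j) + int (v j) - 1)"
    proof (rule sum.cong)
      fix j assume "j \<in> J"
      with m have "u j \<le> Poly_Mapping.lookup m j" "Poly_Mapping.lookup m j < v j" by (auto simp: box_def)
      with \<open>j \<in> J\<close> show "int (Poly_Mapping.lookup (refl m) j) + int (Poly_Mapping.lookup m j) = int (u j) + int (v j) - 1"
        by (simp add: lr)
    qed simp
    finally show ?thesis using assms(1) by simp
  qed
  ultimately have "bij_betw refl (degree_slice (box J u v) i) (degree_slice (box J u v) i')"
    by (intro bij_betw_byWitness[where f' = refl]) (fastforce simp: degree_slice_def)+
  then show ?thesis by (rule bij_betw_same_card)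
qed

text \<open>The integer \<open>r\<close> does not depend on \<open>k\<close>: this expresses that
  the boxes are concentric, with \<open>r\<close> twice the degree of the common centre.\<close>

locale box_chain =
  fixes n t :: nat and U :: "nat \<Rightarrow> (nat \<Rightarrow>\<^sub>0 nat) set" and u v :: "nat \<Rightarrow> nat \<Rightarrow> nat" and r :: int
  assumes up_closed: "k \<le> t \<Longrightarrow> up_closed n (U k)"
    and antimono: "k < t \<Longrightarrow> U (Suc k) \<subseteq> U k"
    and box: "k < t \<Longrightarrow> U k - U (Suc k) = box {1..n} (u k) (v k)"
    and centre: "k < t \<Longrightarrow> r = (\<Sum>j=1..n. int (u k j) + int (v k j) - 1)"
begin

lemma antimono_0: "k \<le> t \<Longrightarrow> U k \<subseteq> U 0"
  by (induction k) (use antimono in \<open>auto simp: Suc_le_eq dest: less_imp_le\<close>)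

lemma diff_eq: "k < t \<Longrightarrow> U 0 - U (Suc k) = (U 0 - U k) \<union> box {1..n} (u k) (v k)"
  using antimono_0[of k] antimono[of k] box[of k] by auto

text \<open>Since \<open>linear_form n ^ k * p\<close> lies in the last ideal, it lies in all of
  them; so the result for a single box pushes \<open>p\<close> from \<open>U b\<close> to
  \<open>U (Suc b)\<close> until the end of the chain.\<close>

lemma injective:
  fixes p :: "('k :: field_char_0) mpoly"
  assumes p: "p \<in> supported (U 0)" "homogeneous i p" "2 * int i + int k \<le> r"
    and lp: "linear_form n ^ k * p \<in> supported (U t)"
  shows "p \<in> supported (U t)"
proof -
  have Ut: "b \<le> t \<Longrightarrow> U t \<subseteq> U b" for b
    by (induction b rule: inc_induct) (use antimono in auto)
  have "p \<in> supported (U b)" if "b \<le> t" for b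
    using that
  proof (induction b)
    case (Suc b)
    show ?case
    proof (rule linear_form_power_injective_box[OF up_closed up_closed box centre])
      show "linear_form n ^ k * p \<in> supported (U (Suc b))"
        using lp Ut[OF Suc.prems] by (auto simp: supported_def)
    qed (use Suc p in auto)
  qed (use p in simp)
  then show ?thesis by simp
qed

lemma symmetric:
  assumes "int i + int j = r" "k \<le> t"
  shows "card (degree_slice (U 0 - U k) i) = card (degree_slice (U 0 - U k) j)"
  using assms(2)
proof (induction k)
  case (Suc k)
  let ?B = "box {1..n} (u k) (v k)"
  have k: "k < t" using Suc.prems by simp
  have "card (degree_slice (U 0 - U (Suc k)) i) = card (degree_slice (U 0 - U k) i) + card (degree_slice ?B i)" for i
  proof -
    have "degree_slice (U 0 - U (Suc k)) i = degree_slice (U 0 - U k) i \<union> degree_slice ?B i"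
      using diff_eq[OF k] by (auto simp: degree_slice_def)
    moreover have "degree_slice (U 0 - U k) i \<inter> degree_slice ?B i = {}"
      using box[OF k] by (auto simp: degree_slice_def)
    moreover have "U 0 \<subseteq> monomials n" using up_closed[of 0] by (simp add: up_closed_def)
    then have "finite (degree_slice (U 0 - U k) i)" "finite (degree_slice ?B i)"
      by (auto intro!: finite_degree_slice[of _ n] simp: box_def monomials_def)
    ultimately show ?thesis by (simp add: card_Un_disjoint)
  qed
  then show ?case
    using Suc card_degree_slice_box[of i j "u k" "v k" "{1..n}"] centre[OF k] assms(1) by simp
qed (simp add: degree_slice_def)

lemma degree_bound:
  assumes "m \<in> U 0 - U t"
  shows "int (mon_degree m) \<le> r"
proof -
  have "\<exists>k<t. m \<in> box {1..n} (u k) (v k)" if "b \<le> t" "m \<notin> U b" for b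
    using that
  proof (induction b)
    case (Suc b)
    show ?case
    proof (cases "m \<in> U b")
      case True
      then have "m \<in> box {1..n} (u b) (v b)" using box[of b] Suc.prems by auto
      with Suc.prems show ?thesis by (auto simp: Suc_le_eq)
    qed (use Suc in simp)
  qed (use assms in auto)
  then obtain k where k: "k < t" "m \<in> box {1..n} (u k) (v k)" using assms by blast
  then have "int (mon_degree m) = (\<Sum>j=1..n. int (Poly_Mapping.lookup m j))"
    by (subst mon_degree_superset[of _ "{1..n}"]) (auto simp: box_def)
  \<comment> \<open>Crude but sufficient: \<open>v k j - 1\<close> already bounds the exponent, and
    \<open>u k j\<close> is nonnegative.\<close>
  also have "\<dots> \<le> (\<Sum>j=1..n. int (u k j) + int (v k j) - 1)"
  proof (rule sum_mono)
    fix j assume "j \<in> {1..n}"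
    with k have "Poly_Mapping.lookup m j < v k j" by (auto simp: box_def)
    then show "int (Poly_Mapping.lookup m j) \<le> int (u k j) + int (v k j) - 1" by simp
  qed
  finally show ?thesis using centre[OF k(1)] by simp
qed

end

section \<open>The monomial ideal of a table\<close>

definition table_exp :: "(nat \<Rightarrow> nat) \<Rightarrow> (nat \<Rightarrow> nat \<Rightarrow> nat) \<Rightarrow> nat \<Rightarrow> nat \<Rightarrow> nat" where
  "table_exp d \<alpha> k j = d j - (\<Sum>i=1..k. \<alpha> i j)"

text \<open>The monomials of the summand \<open>K_k\<close>; for \<open>k = 0\<close> the first
  condition is void and those of \<open>K_0\<close> remain.\<close>

definition table_level :: "nat \<Rightarrow> (nat \<Rightarrow> nat \<Rightarrow> nat) \<Rightarrow> nat \<Rightarrow> (nat \<Rightarrow>\<^sub>0 nat) set" where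
  "table_level n e k = {m \<in> monomials n. (\<forall>j\<in>{1..k}. e j j \<le> Poly_Mapping.lookup m j) \<and>
     (\<exists>j\<in>{k+1..n}. e k j \<le> Poly_Mapping.lookup m j)}"

definition table_monomials :: "nat \<Rightarrow> nat \<Rightarrow> (nat \<Rightarrow> nat \<Rightarrow> nat) \<Rightarrow> (nat \<Rightarrow>\<^sub>0 nat) set" where
  "table_monomials s n e = (\<Union>k\<le>s. table_level n e k)"

lemma up_closed_table_monomials: "up_closed n (table_monomials s n e)"
  unfolding up_closed_def table_monomials_def table_level_def
  by (fastforce simp: lookup_add intro: trans_le_add2)

text \<open>The common factor involves only \<open>x_1, ..., x_k\<close> and the generators only the
  later variables, so dividing by the factor leaves the condition on the later exponents
  unchanged.\<close>

lemma table_summand_eq_supported: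
  assumes "k \<le> n"
  shows "table_summand n d \<alpha> k = (supported (table_level n (table_exp d \<alpha>) k) :: ('a :: comm_ring_1) mpoly set)"
proof -
  let ?e = "table_exp d \<alpha>"
  define c where "c = (\<Sum>j=1..k. Poly_Mapping.single j (?e j j))"
  let ?M = "{m \<in> monomials n. \<exists>j\<in>{k+1..n}. ?e k j \<le> Poly_Mapping.lookup m j}"
  have lc: "Poly_Mapping.lookup c j = (if j \<in> {1..k} then ?e j j else 0)" for j
    by (simp add: c_def lookup_sum lookup_single when_def)
  have "table_summand n d \<alpha> k = Poly_Mapping.single c 1 <#\<^bsub>mpoly_ring n\<^esub> (supported ?M :: 'a mpoly set)"
    unfolding table_summand_def table_exp_def[symmetric] prod_var_power c_def
    by (subst genideal_var_powers) auto
  also have "\<dots> = supported ((+) c ` ?M)" by (rule l_coset_supported)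
  also have "(+) c ` ?M = table_level n ?e k"
  proof (intro equalityI subsetI)
    fix m assume "m \<in> (+) c ` ?M"
    moreover have "c \<in> monomials n" using assms by (auto simp: mem_monomials_lookup lc)
    ultimately show "m \<in> table_level n ?e k"
      by (auto simp: table_level_def lookup_add lc) force
  next
    fix m assume m: "m \<in> table_level n ?e k"
    have "m = c + (m - c)"
      using m by (intro poly_mapping_eqI) (auto simp: table_level_def lookup_add lookup_minus lc)
    moreover have "m - c \<in> ?M"
      using m minus_mem_monomials by (auto simp: table_level_def lookup_minus lc)
    ultimately show "m \<in> (+) c ` ?M" by (rule image_eqI)
  qed
  finally show ?thesis .
qed

lemma table_ideal_eq_supported:
  "s < n \<Longrightarrow> table_ideal s n d \<alpha> =
    (supported (table_monomials s n (table_exp d \<alpha>)) :: ('a :: comm_ring_1) mpoly set)"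
proof (induction s)
  case 0
  have "table_ideal 0 n d \<alpha> = (supported (table_level n (table_exp d \<alpha>) 0) :: 'a mpoly set)"
    by (simp add: genideal_var_powers table_level_def table_exp_def)
  then show ?case by (simp add: table_monomials_def)
next
  case (Suc s)
  then show ?case
    by (simp add: table_summand_eq_supported set_add_supported table_monomials_def atMost_Suc Un_commute)
qed

text \<open>The monomials of \<open>K + (x_1^(e 1 1) ... x_k^(e k k))\<close>. The chain starts at
  \<open>R\<close> and, once the table is extended by zero rows, reaches \<open>K\<close> at
  \<open>k = s + 1\<close>.\<close>

definition table_chain :: "nat \<Rightarrow> nat \<Rightarrow> (nat \<Rightarrow> nat \<Rightarrow> nat) \<Rightarrow> nat \<Rightarrow> (nat \<Rightarrow>\<^sub>0 nat) set" where
  "table_chain s n e k = table_monomials s n e \<union>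
     {m \<in> monomials n. \<forall>j\<in>{1..k}. e j j \<le> Poly_Mapping.lookup m j}"

definition table_lower :: "(nat \<Rightarrow> nat \<Rightarrow> nat) \<Rightarrow> nat \<Rightarrow> nat \<Rightarrow> nat" where
  "table_lower e k j = (if j \<le> k then e j j else 0)"

text \<open>For \<open>j <= k\<close> the side is \<open>[e j j, e (j-1) j)\<close>, of length
  \<open>\<alpha> j j\<close> for a table: beyond it the monomial falls into \<open>K_(j-1)\<close>.
  Direction \<open>k+1\<close> stops where the next member of the chain begins, and the later
  directions stop at the generators of \<open>K_k\<close>.\<close>

definition table_upper :: "(nat \<Rightarrow> nat \<Rightarrow> nat) \<Rightarrow> nat \<Rightarrow> nat \<Rightarrow> nat" where
  "table_upper e k j = (if j \<le> k then e (j - 1) j else if j = Suc k then e j j else e k j)"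

text \<open>Inside the \<open>k\<close>-th member of the chain, avoiding \<open>K_k'\<close> for
  \<open>k' <= k\<close> means \<open>m_j < e k' j\<close> for all \<open>j > k'\<close>. As
  \<open>e\<close> decreases in its first argument, only the largest admissible \<open>k'\<close>
  matters for each \<open>j\<close>.\<close>

lemma table_chain_box:
  assumes "s < n" "k \<le> s" and anti: "\<And>k k' j. k \<le> k' \<Longrightarrow> e k' j \<le> e k j"
  shows "table_chain s n e k - table_chain s n e (Suc k) = box {1..n} (table_lower e k) (table_upper e k)"
    (is "?D = ?B")
proof (intro equalityI subsetI)
  let ?l = "Poly_Mapping.lookup"
  fix m assume m: "m \<in> ?D"
  then have mon: "m \<in> monomials n" and low: "\<And>j. j \<in> {1..k} \<Longrightarrow> e j j \<le> ?l m j"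
    and "\<not> (\<forall>j\<in>{1..Suc k}. e j j \<le> ?l m j)"
    and notM: "\<And>k'. k' \<le> s \<Longrightarrow> m \<notin> table_level n e k'"
    by (auto simp: table_chain_def table_monomials_def)
  then have k1: "?l m (Suc k) < e (Suc k) (Suc k)"
    by (metis atLeastAtMost_iff le_SucE not_le)
  have lt: "?l m j < e k' j" if "k' \<le> k" "j \<in> {k'+1..n}" for k' j
    using notM[of k'] that low mon \<open>k \<le> s\<close> by (force simp: table_level_def)
  \<comment> \<open>The sharpest choices are \<open>k' = j - 1\<close> for \<open>j <= k\<close> and
    \<open>k' = k\<close> for later directions.\<close>
  have "table_lower e k j \<le> ?l m j \<and> ?l m j < table_upper e k j" if j: "j \<in> {1..n}" for j
    using j low[of j] k1 lt[of "j - 1" j] lt[of k j] by (auto simp: table_lower_def table_upper_def)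
  with mon show "m \<in> ?B" by (auto simp: box_def monomials_def)
next
  let ?l = "Poly_Mapping.lookup"
  fix m assume m: "m \<in> ?B"
  then have mon: "m \<in> monomials n" by (simp add: box_def monomials_def)
  have low: "e j j \<le> ?l m j" if "j \<in> {1..k}" for j
    using m that assms(1,2) by (force simp: box_def table_lower_def)
  have up: "?l m j < table_upper e k j" if "j \<in> {1..n}" for j
    using m that by (simp add: box_def)
  have k1: "?l m (Suc k) < e (Suc k) (Suc k)"
    using up[of "Suc k"] assms(1,2) by (simp add: table_upper_def)
  have "m \<notin> table_level n e k'" for k'
  proof
    assume "m \<in> table_level n e k'"
    then obtain j where k': "\<And>j. j \<in> {1..k'} \<Longrightarrow> e j j \<le> ?l m j"
      and j: "j \<in> {k'+1..n}" "e k' j \<le> ?l m j" by (auto simp: table_level_def)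
    \<comment> \<open>A level beyond \<open>k\<close> would require \<open>x_(k+1)\<close> to have
      exponent at least \<open>e (k+1) (k+1)\<close>.\<close>
    have "k' \<le> k" using k'[of "Suc k"] k1 by force
    moreover have "table_upper e k j \<le> e k' j"
      using \<open>k' \<le> k\<close> j(1) by (auto simp: table_upper_def intro: anti)
    ultimately show False using up[of j] j by simp
  qed
  moreover have "\<not> (\<forall>j\<in>{1..Suc k}. e j j \<le> ?l m j)"
    using k1 by (metis atLeastAtMost_iff le_add1 not_le order_refl plus_1_eq_Suc)
  ultimately show "m \<in> ?D" using mon low by (auto simp: table_chain_def table_monomials_def)
qed

text \<open>Passing from box \<open>k\<close> to box \<open>k + 1\<close> changes the sum by
  \<open>e k (k+1)\<close>, minus the entries of row \<open>k + 1\<close> right of the diagonal,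
  minus \<open>\<alpha> (k+2) (k+2)\<close>. Condition (3) for \<open>k + 1\<close> says precisely
  that this is zero, so the value at \<open>k = 0\<close> persists.\<close>

lemma table_centre:
  assumes "s < n" "k \<le> s"
    and e: "\<And>k j. j \<in> {1..n} \<Longrightarrow> int (e k j) = int (d j) - (\<Sum>i=1..k. int (\<alpha> i j))"
    and d: "\<And>k. k \<in> {1..s} \<Longrightarrow>
      d k = (\<Sum>i=1..<k. \<alpha> i k) + (\<Sum>j=k+1..n. \<alpha> k j) + \<alpha> (k+1) (k+1)"
  shows "(\<Sum>j=1..n. int (table_lower e k j) + int (table_upper e k j) - 1)
    = (\<Sum>j=1..n. int (d j)) - int (\<alpha> 1 1) - int n"
  using assms(2)
proof (induction k)
  case 0
  have "int (table_lower e 0 j) + int (table_upper e 0 j) - 1 =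
      int (d j) - (if j = 1 then int (\<alpha> 1 1) else 0) - 1" if "j \<in> {1..n}" for j
    using that e[OF that] by (auto simp: table_lower_def table_upper_def)
  then show ?case using \<open>s < n\<close> by (simp add: sum_subtractf)
next
  case (Suc k)
  let ?w = "\<lambda>k j. int (table_lower e k j) + int (table_upper e k j) - 1"
  have kn: "Suc (Suc k) \<le> n" using Suc.prems \<open>s < n\<close> by simp
  \<comment> \<open>Direction \<open>k+1\<close> turns from \<open>[0, e (k+1) (k+1))\<close> into
    \<open>[e (k+1) (k+1), e k (k+1))\<close>. Later upper bounds drop by the entry in row
    \<open>k+1\<close>, and direction \<open>k+2\<close> drops by its diagonal entry as
    well.\<close>
  have step: "?w (Suc k) j = ?w k j + (if j = Suc k then int (e k j) else 0)
      - (if j \<in> {Suc k + 1..n} then int (\<alpha> (Suc k) j) else 0)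
      - (if j = Suc (Suc k) then int (\<alpha> j j) else 0)" if j: "j \<in> {1..n}" for j
  proof -
    consider "j \<le> k" | "j = Suc k" | "j = Suc (Suc k)" | "j > Suc (Suc k)" by linarith
    then show ?thesis
      using e[OF j] j by cases (auto simp: table_lower_def table_upper_def)
  qed
  have "(\<Sum>j=1..n. ?w (Suc k) j) = (\<Sum>j=1..n. ?w k j) + int (e k (Suc k))
      - (\<Sum>j=Suc k + 1..n. int (\<alpha> (Suc k) j)) - int (\<alpha> (Suc (Suc k)) (Suc (Suc k)))"
  proof -
    have eq: "(\<Sum>j=1..n. w' j) = (\<Sum>j=1..n. w j) + (\<Sum>j=1..n. f j) - (\<Sum>j=1..n. g j) - (\<Sum>j=1..n. h j)"
      if "\<And>j. j \<in> {1..n} \<Longrightarrow> w' j = w j + f j - g j - h j" for w' w f g h :: "nat \<Rightarrow> int"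
      using that by (simp add: sum_subtractf sum.distrib)
    have "{1..n} \<inter> {Suc k + 1..n} = {Suc k + 1..n}" by auto
    then have "(\<Sum>j=1..n. if j \<in> {Suc k + 1..n} then int (\<alpha> (Suc k) j) else 0) = (\<Sum>j=Suc k + 1..n. int (\<alpha> (Suc k) j))"
      by (metis (no_types) finite_atLeastAtMost sum.inter_restrict)
    with kn show ?thesis by (subst eq[OF step]) simp_all
  qed
  also have "int (e k (Suc k)) = int (d (Suc k)) - (\<Sum>i=1..<Suc k. int (\<alpha> i (Suc k)))"
    using e[of "Suc k" k] kn by (simp add: atLeastLessThanSuc_atLeastAtMost)
  also have "int (d (Suc k)) = (\<Sum>i=1..<Suc k. int (\<alpha> i (Suc k))) + (\<Sum>j=Suc k+1..n. int (\<alpha> (Suc k) j))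
      + int (\<alpha> (Suc (Suc k)) (Suc (Suc k)))"
    using arg_cong[OF d[of "Suc k"], of int] Suc.prems by simp
  finally show ?case using Suc by simp
qed

theorem theorem3:
  fixes s n :: nat and d :: "nat \<Rightarrow> nat" and \<alpha> :: "nat \<Rightarrow> nat \<Rightarrow> nat"
    and K :: "('k :: field_char_0) mpoly set"
  assumes "is_table s n d \<alpha>" and "s \<ge> 1" and "K = table_ideal s n d \<alpha>"
  shows "strong_lefschetz_narrow (mpoly_ring n Quot K) (quot_scalars n K) (quot_component n K)
    \<and> (K \<noteq> carrier (mpoly_ring n) \<longrightarrow>
        (\<exists>r. max_socle_degree (mpoly_ring n Quot K) (quot_component n K) r \<and>
             int r = (\<Sum>j=1..n. int (d j)) - int (\<alpha> 1 1) - int n))"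
proof -
  \<comment> \<open>Zero rows below row \<open>s\<close> absorb the convention on
    \<open>\<alpha> (s+1) (s+1)\<close> in condition (3), whatever values \<open>\<alpha>\<close>
    takes there.\<close>
  define \<beta> where "\<beta> i j = (if i \<le> s then \<alpha> i j else 0)" for i j
  define e where "e = table_exp d \<beta>"
  define r where "r = (\<Sum>j=1..n. int (d j)) - int (\<alpha> 1 1) - int n"
  let ?S = "table_monomials s n e"
  have sn: "s < n" using assms(1) by (simp add: is_table_def)
  have "table_level n (table_exp d \<alpha>) k = table_level n e k" if "k \<le> s" for k
    unfolding table_level_def using that by (auto simp: e_def table_exp_def \<beta>_def)
  then have K: "K = supported ?S"
    using assms(3) sn by (simp add: table_ideal_eq_supported table_monomials_def)
  have le: "(\<Sum>i=1..k. \<beta> i j) \<le> d j" if "j \<in> {1..n}" for j k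
  proof -
    have "(\<Sum>i=1..k. \<beta> i j) = (\<Sum>i\<in>{1..k} \<inter> {..s}. \<beta> i j)"
      by (rule sum.mono_neutral_right) (auto simp: \<beta>_def)
    also have "\<dots> = (\<Sum>i\<in>{1..k} \<inter> {..s}. \<alpha> i j)"
      by (rule sum.cong) (auto simp: \<beta>_def)
    also have "\<dots> \<le> (\<Sum>i=1..s. \<alpha> i j)" by (rule sum_mono2) auto
    also have "\<dots> \<le> d j" using assms(1) that by (simp add: is_table_def)
    finally show ?thesis .
  qed
  have e_int: "int (e k j) = int (d j) - (\<Sum>i=1..k. int (\<beta> i j))" if "j \<in> {1..n}" for k j
    using le[OF that, of k] by (simp add: e_def table_exp_def of_nat_diff)
  have anti: "e k' j \<le> e k j" if "k \<le> k'" for k k' j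
    unfolding e_def table_exp_def using that by (intro diff_le_mono2 sum_mono2) auto
  have d: "d k = (\<Sum>i=1..<k. \<beta> i k) + (\<Sum>j=k+1..n. \<beta> k j) + \<beta> (k+1) (k+1)" if "k \<in> {1..s}" for k
    using assms(1) that by (auto simp: is_table_def \<beta>_def)
  have chain_0: "table_chain s n e 0 = monomials n"
    using up_closed_table_monomials[of n s e] by (auto simp: table_chain_def up_closed_def)
  have chain_end: "table_chain s n e (Suc s) = ?S"
  proof -
    \<comment> \<open>Row \<open>s + 1\<close> is zero, so the condition added by the last member of
      the chain is the generator of \<open>K_s\<close> in the variable \<open>x_(s+1)\<close>, which
      exists because \<open>s < n\<close>.\<close>
    have "m \<in> table_level n e s" if m: "m \<in> monomials n" "\<forall>j\<in>{1..Suc s}. e j j \<le> Poly_Mapping.lookup m j" for m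
    proof -
      have "e s (Suc s) = e (Suc s) (Suc s)" by (simp add: e_def table_exp_def \<beta>_def)
      then have "e s (Suc s) \<le> Poly_Mapping.lookup m (Suc s)" using m by simp
      then show ?thesis using m sn by (auto simp: table_level_def intro!: bexI[of _ "Suc s"])
    qed
    then show ?thesis by (auto simp: table_chain_def table_monomials_def)
  qed
  interpret C: box_chain n "Suc s" "table_chain s n e" "table_lower e" "table_upper e" r
  proof
    fix k
    have "up_closed n {m \<in> monomials n. \<forall>j\<in>{1..k}. e j j \<le> Poly_Mapping.lookup m j}"
      by (auto simp: up_closed_def lookup_add intro: trans_le_add2)
    then show "up_closed n (table_chain s n e k)"
      unfolding table_chain_def by (intro up_closed_Un up_closed_table_monomials)
    show "table_chain s n e (Suc k) \<subseteq> table_chain s n e k" by (auto simp: table_chain_def)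
    assume k: "k < Suc s"
    show "table_chain s n e k - table_chain s n e (Suc k) = box {1..n} (table_lower e k) (table_upper e k)"
      by (rule table_chain_box) (use k sn anti in auto)
    \<comment> \<open>Here \<open>s >= 1\<close> enters: row 1 must belong to the table for
      \<open>\<alpha> 1 1\<close> to appear in the socle degree.\<close>
    have "\<beta> 1 1 = \<alpha> 1 1" using assms(2) by (simp add: \<beta>_def)
    then show "r = (\<Sum>j=1..n. int (table_lower e k j) + int (table_upper e k j) - 1)"
      using table_centre[of s n k e d \<beta>, OF sn _ e_int d] k by (simp add: r_def)
  qed
  interpret Q: monomial_quotient n ?S K
    by unfold_locales (rule up_closed_table_monomials, rule K)
  note C_props = C.injective C.symmetric[OF _ order_refl] C.degree_bound
  note lefschetz = Q.lefschetz_of_injective[OF _ C_props(2,3)[unfolded chain_0 chain_end]]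
  have inj: "p \<in> K" if "p \<in> supported (monomials n)" "homogeneous i p" "2 * int i + int k \<le> r"
    "linear_form n ^ k * p \<in> K" for p i k
    using C_props(1)[unfolded chain_0 chain_end] that unfolding K by blast
  have "strong_lefschetz_narrow (mpoly_ring n Quot K) (quot_scalars n K) (quot_component n K)"
    by (rule lefschetz(1)) (fact inj)
  moreover have "\<exists>t. max_socle_degree (mpoly_ring n Quot K) (quot_component n K) t \<and> int t = r"
    if "K \<noteq> carrier (mpoly_ring n)"
    by (rule lefschetz(2)) (fact inj | fact that | assumption)+
  ultimately show ?thesis unfolding r_def by blast
qed

end
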